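(* Let $(p,d)\in\{(2,2),(2,3),(2,4),(2,5),(3,2),(3,3),(5,2)\}$. Then (i) the scheme $C(p^d)$ is separable, and (ii) every cyclotomic scheme of degree $p^d$ is $2$-separable.
   Context: A coherent configuration is a pair $\mathcal X=(\Omega,S)$, $\Omega$ finite, $S$ a partition of $\Omega\times\Omega$ with the diagonal a union of elements of $S$, $S$ closed under transposition $r\mapsto r^*$, and with intersection numbers $c_{rs}^t=|\{\gamma:(\alpha,\gamma)\in r,(\gamma,\beta)\in s\}|$ independent of $(\alpha,\beta)\in t$; it is a scheme if the diagonal is in $S$. Isomorphisms are bijections of point sets mapping basis relations onto basis relations; algebraic isomorphisms are bijections of the sets of basis relations preserving all intersection numbers; $\varphi$ is induced by $f$ if $\varphi(s)=s^f$ for all $s$. $\mathcal X$ is separable if every algebraic isomorphism from it is induced by an isomorphism. For a field $\mathbb F$ of order $p^d$, $C(p^d)$ is the scheme on $\mathbb F^\times$ with basis relations $\{(ax^\sigma,ay^\sigma):a\in\mathbb F^\times,\sigma\in\mathrm{Aut}(\mathbb F)\}$, $x,y\in\mathbb F^\times$. For a subgroup $M\le\mathbb F^\times$, the cyclotomic scheme is the scheme on $\mathbb F$ with basis relations $\{(x,y):y-x\in Ma\}$, $a\in\mathbb F$; its degree is $|\mathbb F|$. $2$-separability: the tensor square $\mathcal X\otimes\mathcal X$ is the coherent configuration on $\Omega^2$ with basis relations $r\otimes s=\{((\alpha_1,\alpha_2),(\beta_1,\beta_2)):(\alpha_1,\beta_1)\in r,(\alpha_2,\beta_2)\in s\}$.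 The $2$-extension $\widehat{\mathcal X}^{(2)}$ is the minimal fission of $\mathcal X\otimes\mathcal X$ in which the diagonal relation $1_D$, $D=\{(\alpha,\alpha):\alpha\in\Omega\}$, is a union of basis relations. With $\Delta(s)=\{((\alpha,\alpha),(\beta,\beta)):(\alpha,\beta)\in s\}$, an algebraic isomorphism $\varphi:\mathcal X\to\mathcal X'$ is a $2$-isomorphism if there is an algebraic isomorphism $\psi:\widehat{\mathcal X}^{(2)}\to\widehat{\mathcal X'}^{(2)}$ with $\psi(\Delta(s))=\Delta(\varphi(s))$ for all $s\in S$; $\mathcal X$ is $2$-separable if every $2$-isomorphism from $\mathcal X$ is induced by an isomorphism. *)

theory Defs
  imports Main "HOL-Library.Disjoint_Sets" "HOL-Library.Cardinality"
begin

section \<open>Coherent configurations\<close>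

text \<open>A configuration on the point set \<open>\<Omega>\<close> is given by its set \<open>S\<close> of basis relations.\<close>

definition is_union_of :: "'a set \<Rightarrow> 'a set set \<Rightarrow> bool" where
  "is_union_of R S \<longleftrightarrow> (\<exists>T\<subseteq>S. R = \<Union>T)"

definition coherent_configuration :: "'a set \<Rightarrow> ('a \<times> 'a) set set \<Rightarrow> bool" where
  "coherent_configuration \<Omega> S \<longleftrightarrow>
     finite \<Omega> \<and> partition_on (\<Omega> \<times> \<Omega>) S \<and> is_union_of (Id_on \<Omega>) S \<and> (\<forall>r\<in>S. r\<inverse> \<in> S) \<and>
     (\<forall>r\<in>S. \<forall>s\<in>S. \<forall>t\<in>S. \<exists>c. \<forall>(\<alpha>, \<beta>)\<in>t. card {\<gamma>. (\<alpha>, \<gamma>) \<in> r \<and> (\<gamma>, \<beta>) \<in> s} = c)"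

definition scheme :: "'a set \<Rightarrow> ('a \<times> 'a) set set \<Rightarrow> bool" where
  "scheme \<Omega> S \<longleftrightarrow> coherent_configuration \<Omega> S \<and> Id_on \<Omega> \<in> S"

text \<open>The intersection number \<open>c\<^sub>r\<^sub>s\<^sup>t\<close>; it is meaningful for basis relations of one coherent
  configuration.\<close>

definition intersection_number ::
    "('a \<times> 'a) set \<Rightarrow> ('a \<times> 'a) set \<Rightarrow> ('a \<times> 'a) set \<Rightarrow> nat" where
  "intersection_number r s t =
     (THE c. \<forall>(\<alpha>, \<beta>)\<in>t. card {\<gamma>. (\<alpha>, \<gamma>) \<in> r \<and> (\<gamma>, \<beta>) \<in> s} = c)"

definition isomorphism ::
    "'a set \<Rightarrow> ('a \<times> 'a) set set \<Rightarrow> 'b set \<Rightarrow> ('b \<times> 'b) set set \<Rightarrow> ('a \<Rightarrow> 'b) \<Rightarrow> bool" where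
  "isomorphism \<Omega> S \<Omega>' S' f \<longleftrightarrow> bij_betw f \<Omega> \<Omega>' \<and> (\<lambda>s. map_prod f f ` s) ` S = S'"

definition algebraic_isomorphism ::
    "('a \<times> 'a) set set \<Rightarrow> ('b \<times> 'b) set set \<Rightarrow> (('a \<times> 'a) set \<Rightarrow> ('b \<times> 'b) set) \<Rightarrow> bool" where
  "algebraic_isomorphism S S' \<phi> \<longleftrightarrow>
     bij_betw \<phi> S S' \<and>
     (\<forall>r\<in>S. \<forall>s\<in>S. \<forall>t\<in>S.
        intersection_number (\<phi> r) (\<phi> s) (\<phi> t) = intersection_number r s t)"

definition induced_by ::
    "('a \<times> 'a) set set \<Rightarrow> (('a \<times> 'a) set \<Rightarrow> ('b \<times> 'b) set) \<Rightarrow> ('a \<Rightarrow> 'b) \<Rightarrow> bool" where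
  "induced_by S \<phi> f \<longleftrightarrow> (\<forall>s\<in>S. \<phi> s = map_prod f f ` s)"

text \<open>The type argument is the type of the points of the target configurations. A statement about
  \<open>separable\<close> is meant to be made for every type \<open>'b\<close>, i.e. with a free type variable.\<close>

definition separable :: "'b itself \<Rightarrow> 'a set \<Rightarrow> ('a \<times> 'a) set set \<Rightarrow> bool" where
  "separable _ \<Omega> S \<longleftrightarrow>
     (\<forall>(\<Omega>' :: 'b set) S' \<phi>.
        coherent_configuration \<Omega>' S' \<and> algebraic_isomorphism S S' \<phi> \<longrightarrow>
        (\<exists>f. isomorphism \<Omega> S \<Omega>' S' f \<and> induced_by S \<phi> f))"


section \<open>The 2-extension and 2-separability\<close>

definition tensor_rel ::
    "('a \<times> 'a) set \<Rightarrow> ('b \<times> 'b) set \<Rightarrow> (('a \<times> 'b) \<times> ('a \<times> 'b)) set" where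
  "tensor_rel r s = {((\<alpha>\<^sub>1, \<alpha>\<^sub>2), (\<beta>\<^sub>1, \<beta>\<^sub>2)). (\<alpha>\<^sub>1, \<beta>\<^sub>1) \<in> r \<and> (\<alpha>\<^sub>2, \<beta>\<^sub>2) \<in> s}"

definition tensor_square :: "('a \<times> 'a) set set \<Rightarrow> (('a \<times> 'a) \<times> ('a \<times> 'a)) set set" where
  "tensor_square S = {tensor_rel r s | r s. r \<in> S \<and> s \<in> S}"

text \<open>A fission of \<open>S\<close> is a coherent configuration on the same points whose basis relations
  refine those of \<open>S\<close>. Below, \<open>Id_on \<Omega>\<close> plays the role of the set of points
  \<open>D = {(\<alpha>, \<alpha>). \<alpha> \<in> \<Omega>}\<close>, so that \<open>Id_on (Id_on \<Omega>)\<close> is \<open>1\<^sub>D\<close>.\<close>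

definition diagonal_fission ::
    "'a set \<Rightarrow> ('a \<times> 'a) set set \<Rightarrow> (('a \<times> 'a) \<times> ('a \<times> 'a)) set set \<Rightarrow> bool" where
  "diagonal_fission \<Omega> S Y \<longleftrightarrow>
     coherent_configuration (\<Omega> \<times> \<Omega>) Y \<and>
     refines ((\<Omega> \<times> \<Omega>) \<times> (\<Omega> \<times> \<Omega>)) Y (tensor_square S) \<and>
     is_union_of (Id_on (Id_on \<Omega>)) Y"

text \<open>``Minimal'' refers to the order in which the coarser configuration is the smaller one.\<close>

definition is_two_extension ::
    "'a set \<Rightarrow> ('a \<times> 'a) set set \<Rightarrow> (('a \<times> 'a) \<times> ('a \<times> 'a)) set set \<Rightarrow> bool" where
  "is_two_extension \<Omega> S Y \<longleftrightarrow>
     diagonal_fission \<Omega> S Y \<and>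
     (\<forall>Z. diagonal_fission \<Omega> S Z \<longrightarrow> refines ((\<Omega> \<times> \<Omega>) \<times> (\<Omega> \<times> \<Omega>)) Z Y)"

definition two_extension ::
    "'a set \<Rightarrow> ('a \<times> 'a) set set \<Rightarrow> (('a \<times> 'a) \<times> ('a \<times> 'a)) set set" where
  "two_extension \<Omega> S = (THE Y. is_two_extension \<Omega> S Y)"

definition Delta :: "('a \<times> 'a) set \<Rightarrow> (('a \<times> 'a) \<times> ('a \<times> 'a)) set" where
  "Delta s = {((\<alpha>, \<alpha>), (\<beta>, \<beta>)) | \<alpha> \<beta>. (\<alpha>, \<beta>) \<in> s}"

text \<open>\<open>Delta s\<close> is in general not a basis relation of the 2-extension but only a union of basis
  relations, so algebraic isomorphisms have to be extended to such unions in the usual way.\<close>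

definition on_unions ::
    "('a \<times> 'a) set set \<Rightarrow> (('a \<times> 'a) set \<Rightarrow> ('b \<times> 'b) set) \<Rightarrow>
     ('a \<times> 'a) set \<Rightarrow> ('b \<times> 'b) set" where
  "on_unions S \<psi> R = \<Union> (\<psi> ` {t \<in> S. t \<subseteq> R})"

definition two_isomorphism ::
    "'a set \<Rightarrow> ('a \<times> 'a) set set \<Rightarrow> 'b set \<Rightarrow> ('b \<times> 'b) set set \<Rightarrow>
     (('a \<times> 'a) set \<Rightarrow> ('b \<times> 'b) set) \<Rightarrow> bool" where
  "two_isomorphism \<Omega> S \<Omega>' S' \<phi> \<longleftrightarrow>
     algebraic_isomorphism S S' \<phi> \<and>
     (\<exists>\<psi>. algebraic_isomorphism (two_extension \<Omega> S) (two_extension \<Omega>' S') \<psi> \<and>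
          (\<forall>s\<in>S. on_unions (two_extension \<Omega> S) \<psi> (Delta s) = Delta (\<phi> s)))"

definition two_separable :: "'b itself \<Rightarrow> 'a set \<Rightarrow> ('a \<times> 'a) set set \<Rightarrow> bool" where
  "two_separable _ \<Omega> S \<longleftrightarrow>
     (\<forall>(\<Omega>' :: 'b set) S' \<phi>.
        coherent_configuration \<Omega>' S' \<and> two_isomorphism \<Omega> S \<Omega>' S' \<phi> \<longrightarrow>
        (\<exists>f. isomorphism \<Omega> S \<Omega>' S' f \<and> induced_by S \<phi> f))"


section \<open>The schemes of a finite field\<close>

definition field_automorphisms :: "('a::field \<Rightarrow> 'a) set" where
  "field_automorphisms =
     {\<sigma>. bij \<sigma> \<and> (\<forall>x y. \<sigma> (x + y) = \<sigma> x + \<sigma> y) \<and> (\<forall>x y. \<sigma> (x * y) = \<sigma> x * \<sigma> y)}"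

text \<open>The basis relations of the scheme \<open>C(p\<^sup>d)\<close> on the points \<open>UNIV - {0}\<close>.\<close>

definition C_basis :: "('a::field \<times> 'a) set set" where
  "C_basis = {{(a * \<sigma> x, a * \<sigma> y) | a \<sigma>. a \<noteq> 0 \<and> \<sigma> \<in> field_automorphisms} | x y.
                x \<noteq> 0 \<and> y \<noteq> 0}"

definition mult_subgroup :: "'a::field set \<Rightarrow> bool" where
  "mult_subgroup M \<longleftrightarrow>
     M \<subseteq> UNIV - {0} \<and> 1 \<in> M \<and> (\<forall>x\<in>M. \<forall>y\<in>M. x * y \<in> M) \<and> (\<forall>x\<in>M. inverse x \<in> M)"

text \<open>The basis relations of the cyclotomic scheme of \<open>M\<close> on the points \<open>UNIV\<close>; the coset of
  \<open>a = 0\<close> is \<open>{0}\<close> and yields the diagonal.\<close>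

definition cyclotomic_basis :: "'a::field set \<Rightarrow> ('a \<times> 'a) set set" where
  "cyclotomic_basis M = {{(x, y). y - x \<in> (\<lambda>m. m * a) ` M} | a. True}"


section \<open>Well-definedness\<close>

lemma Union_sub_partition:
  assumes P: "partition_on A P" and R: "is_union_of R P" and x: "x \<in> p" "p \<in> P" "x \<in> R"
  shows "p \<subseteq> R"
  using assms unfolding partition_on_def is_union_of_def disjoint_def by blast

lemma coherent_discrete:
  assumes "finite \<Omega>"
  shows "coherent_configuration \<Omega> ((\<lambda>p. {p}) ` (\<Omega> \<times> \<Omega>))"
  unfolding coherent_configuration_def is_union_of_def
proof (intro conjI ballI)
  show "partition_on (\<Omega> \<times> \<Omega>) ((\<lambda>p. {p}) ` (\<Omega> \<times> \<Omega>))" by (rule partition_on_singletons)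
  show "\<exists>T\<subseteq>(\<lambda>p. {p}) ` (\<Omega> \<times> \<Omega>). Id_on \<Omega> = \<Union> T"
    by (rule exI[of _ "(\<lambda>p. {p}) ` Id_on \<Omega>"]) (auto simp: Id_on_def)
qed (use assms in auto)

text \<open>The number of \<open>\<gamma>\<close> only depends on the class of \<open>(\<alpha>, \<beta>)\<close> also for unions of basis relations.\<close>

lemma coherent_union_count:
  assumes cc: "coherent_configuration \<Omega> S" and R: "is_union_of R S" and Q: "is_union_of Q S"
    and t: "t \<in> S" "(\<alpha>, \<beta>) \<in> t" "(\<alpha>', \<beta>') \<in> t"
  shows "card {\<gamma>. (\<alpha>, \<gamma>) \<in> R \<and> (\<gamma>, \<beta>) \<in> Q} = card {\<gamma>. (\<alpha>', \<gamma>) \<in> R \<and> (\<gamma>, \<beta>') \<in> Q}"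
proof -
  have fin: "finite \<Omega>" and part: "partition_on (\<Omega> \<times> \<Omega>) S"
    using cc by (auto simp: coherent_configuration_def)
  have sub: "s \<subseteq> \<Omega> \<times> \<Omega>" if "s \<in> S" for s
    using part that by (auto simp: partition_on_def)
  have dis: "s = s'" if "s \<in> S" "s' \<in> S" "x \<in> s" "x \<in> s'" for s s' x
    using part that by (auto simp: partition_on_def disjoint_def)
  obtain T U where T: "T \<subseteq> S" "R = \<Union>T" and U: "U \<subseteq> S" "Q = \<Union>U"
    using R Q by (auto simp: is_union_of_def)
  have "finite S" using part fin by (auto intro: finite_elements)
  then have finTU: "finite (T \<times> U)" using T U by (auto intro: finite_subset)
  have expand: "card {\<gamma>. (x, \<gamma>) \<in> R \<and> (\<gamma>, y) \<in> Q} =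
      (\<Sum>(r, s)\<in>T \<times> U. card {\<gamma>. (x, \<gamma>) \<in> r \<and> (\<gamma>, y) \<in> s})" for x y
  proof -
    have "{\<gamma>. (x, \<gamma>) \<in> R \<and> (\<gamma>, y) \<in> Q} =
        (\<Union>p\<in>T \<times> U. {\<gamma>. (x, \<gamma>) \<in> fst p \<and> (\<gamma>, y) \<in> snd p})"
      using T U by auto
    also have "card \<dots> = (\<Sum>p\<in>T \<times> U. card {\<gamma>. (x, \<gamma>) \<in> fst p \<and> (\<gamma>, y) \<in> snd p})"
    proof (rule card_UN_disjoint[OF finTU])
      have "{\<gamma>. (x, \<gamma>) \<in> fst p \<and> (\<gamma>, y) \<in> snd p} \<subseteq> \<Omega>" if "p \<in> T \<times> U" for p
        using sub[of "fst p"] that T(1) by (auto dest!: subsetD)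
      then show "\<forall>p\<in>T \<times> U. finite {\<gamma>. (x, \<gamma>) \<in> fst p \<and> (\<gamma>, y) \<in> snd p}"
        using fin finite_subset by blast
      show "\<forall>p\<in>T \<times> U. \<forall>q\<in>T \<times> U. p \<noteq> q \<longrightarrow>
        {\<gamma>. (x, \<gamma>) \<in> fst p \<and> (\<gamma>, y) \<in> snd p} \<inter> {\<gamma>. (x, \<gamma>) \<in> fst q \<and> (\<gamma>, y) \<in> snd q} = {}"
      proof (intro ballI impI)
        fix p q assume p: "p \<in> T \<times> U" and q: "q \<in> T \<times> U" and "p \<noteq> q"
        have "fst p = fst q \<and> snd p = snd q"
          if "(x, \<gamma>) \<in> fst p" "(x, \<gamma>) \<in> fst q" "(\<gamma>, y) \<in> snd p" "(\<gamma>, y) \<in> snd q" for \<gamma>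
        proof -
          have "fst p \<in> S" "fst q \<in> S" "snd p \<in> S" "snd q \<in> S" using p q T(1) U(1) by auto
          then show ?thesis using dis that by blast
        qed
        then show "{\<gamma>. (x, \<gamma>) \<in> fst p \<and> (\<gamma>, y) \<in> snd p} \<inter>
            {\<gamma>. (x, \<gamma>) \<in> fst q \<and> (\<gamma>, y) \<in> snd q} = {}"
          using \<open>p \<noteq> q\<close> by (auto simp: prod_eq_iff)
      qed
    qed
    finally show ?thesis by (simp add: case_prod_beta)
  qed
  have "card {\<gamma>. (\<alpha>, \<gamma>) \<in> r \<and> (\<gamma>, \<beta>) \<in> s} = card {\<gamma>. (\<alpha>', \<gamma>) \<in> r \<and> (\<gamma>, \<beta>') \<in> s}"
    if "(r, s) \<in> T \<times> U" for r s
  proof -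
    have "r \<in> S" "s \<in> S" using that T U by auto
    then obtain c where "\<forall>(\<alpha>, \<beta>)\<in>t. card {\<gamma>. (\<alpha>, \<gamma>) \<in> r \<and> (\<gamma>, \<beta>) \<in> s} = c"
      using cc t(1) unfolding coherent_configuration_def by blast
    from bspec[OF this t(2)] bspec[OF this t(3)] show ?thesis by simp
  qed
  then show ?thesis unfolding expand by (auto intro!: sum.cong)
qed

text \<open>Among the coherent configurations satisfying some conditions of the form ``\<open>R\<close> is a union of
  basis relations'' there is a coarsest one.\<close>

lemma coarsest_coherent:
  assumes fin: "finite \<Omega>" and \<R>: "\<And>R. R \<in> \<R> \<Longrightarrow> R \<subseteq> \<Omega> \<times> \<Omega>"
  shows "\<exists>Y. coherent_configuration \<Omega> Y \<and> (\<forall>R\<in>\<R>. is_union_of R Y) \<and>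
     (\<forall>Z. coherent_configuration \<Omega> Z \<and> (\<forall>R\<in>\<R>. is_union_of R Z) \<longrightarrow> refines (\<Omega> \<times> \<Omega>) Z Y)"
proof -
  define good where
    "good Z \<longleftrightarrow> coherent_configuration \<Omega> Z \<and> (\<forall>R\<in>\<R>. is_union_of R Z)" for Z
  define E where "E = {(p, q). \<exists>Z s. good Z \<and> s \<in> Z \<and> p \<in> s \<and> q \<in> s}\<^sup>*\<inter> (\<Omega> \<times> \<Omega>) \<times> (\<Omega> \<times> \<Omega>)"
  let ?W = "{(p, q). \<exists>Z s. good Z \<and> s \<in> Z \<and> p \<in> s \<and> q \<in> s}"
  define Y where "Y = (\<Omega> \<times> \<Omega>) // E"
  have goodcc: "coherent_configuration \<Omega> Z" if "good Z" for Z
    using that by (simp add: good_def)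
  have goodpart: "partition_on (\<Omega> \<times> \<Omega>) Z" if "good Z" for Z
    using goodcc[OF that] by (simp add: coherent_configuration_def)
  have "is_union_of R ((\<lambda>p. {p}) ` (\<Omega> \<times> \<Omega>))" if "R \<subseteq> \<Omega> \<times> \<Omega>" for R
    unfolding is_union_of_def by (rule exI[of _ "(\<lambda>p. {p}) ` R"]) (use that in auto)
  then have "good ((\<lambda>p. {p}) ` (\<Omega> \<times> \<Omega>))"
    using coherent_discrete[OF fin] \<R> by (auto simp: good_def)
  have symW: "sym ?W" by (auto simp: sym_def)
  have equiv: "equiv (\<Omega> \<times> \<Omega>) E"
  proof (rule equivI)
    show "E \<subseteq> (\<Omega> \<times> \<Omega>) \<times> \<Omega> \<times> \<Omega>" by (auto simp: E_def)
    show "refl_on (\<Omega> \<times> \<Omega>) E" by (auto simp: E_def refl_on_def)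
    show "sym E" using sym_rtrancl[OF symW] by (auto simp: E_def sym_def)
    show "trans E" unfolding E_def trans_def by (blast intro: rtrancl_trans)
  qed
  have partY: "partition_on (\<Omega> \<times> \<Omega>) Y"
    unfolding Y_def by (rule partition_on_quotient[OF equiv])
  have ref: "refines (\<Omega> \<times> \<Omega>) Z Y" if "good Z" for Z
    unfolding refines_def
  proof (intro conjI ballI goodpart[OF that] partY)
    fix s assume s: "s \<in> Z"
    have "s \<noteq> {}" using partition_onD3[OF goodpart[OF \<open>good Z\<close>]] s by auto
    then obtain p where p: "p \<in> s" by blast
    have sub: "s \<subseteq> \<Omega> \<times> \<Omega>" using partition_onD1[OF goodpart[OF \<open>good Z\<close>]] s by auto
    have "s \<subseteq> E `` {p}"
    proof
      fix q assume q: "q \<in> s"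
      then have "(p, q) \<in> ?W" using that s p by auto
      then show "q \<in> E `` {p}" using p q sub unfolding E_def by (blast intro: r_into_rtrancl)
    qed
    moreover have "E `` {p} \<in> Y" using p sub unfolding Y_def by (blast intro: quotientI)
    ultimately show "\<exists>y\<in>Y. s \<subseteq> y" by blast
  qed
  have un: "is_union_of t Z" if "t \<in> Y" "good Z" for t Z
    unfolding is_union_of_def using partition_onD1[OF refines_obtains_subset[OF ref[OF that(2)] that(1)]]
    by (intro exI[of _ "{s \<in> Z. s \<subseteq> t}"]) auto
  text \<open>A property that is constant on the classes of every good configuration is constant on the
    classes of \<open>Y\<close>.\<close>
  have const: "f p = f q"
    if "t \<in> Y" "p \<in> t" "q \<in> t"
      and f: "\<And>Z s p q. good Z \<Longrightarrow> s \<in> Z \<Longrightarrow> p \<in> s \<Longrightarrow> q \<in> s \<Longrightarrow> f p = f q"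
    for t p q and f :: "'a \<times> 'a \<Rightarrow> 'c"
  proof -
    have "(p, q) \<in> E"
      using that(1-3) equiv unfolding Y_def by (meson in_quotient_imp_in_rel empty_subsetI insert_subset)
    then have "(p, q) \<in> ?W\<^sup>*" by (simp add: E_def)
    then show ?thesis
    proof (induction rule: rtrancl_induct)
      case (step y z)
      from step(2) obtain Z s where "good Z" "s \<in> Z" "y \<in> s" "z \<in> s"
        unfolding mem_Collect_eq case_prod_conv by blast
      then have "f y = f z" by (rule f)
      with step.IH show ?case by simp
    qed simp
  qed
  have union_Y: "is_union_of R Y" if R: "R \<subseteq> \<Omega> \<times> \<Omega>" "\<And>Z. good Z \<Longrightarrow> is_union_of R Z" for R
  proof -
    have sub: "t \<subseteq> R" if t: "t \<in> Y" "p \<in> t" "p \<in> R" for t p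
    proof
      fix q assume "q \<in> t"
      then have "(p \<in> R) = (q \<in> R)"
      proof (rule const[OF t(1,2)])
        fix Z s p q assume "good Z" "s \<in> Z" "p \<in> s" "q \<in> s"
        then show "(p \<in> R) = (q \<in> R)"
          using Union_sub_partition[OF goodpart R(2)] by blast
      qed
      with t show "q \<in> R" by simp
    qed
    have cover: "\<exists>t\<in>Y. p \<in> t" if "p \<in> R" for p
      using partY that R(1) by (auto simp: partition_on_def)
    have "R = \<Union> {t \<in> Y. t \<subseteq> R}"
    proof (intro equalityI subsetI)
      fix p assume "p \<in> R"
      with cover sub show "p \<in> \<Union> {t \<in> Y. t \<subseteq> R}" by (metis (mono_tags) UnionI mem_Collect_eq)
    qed auto
    then show ?thesis
      unfolding is_union_of_def by (intro exI[of _ "{t \<in> Y. t \<subseteq> R}"]) auto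
  qed
  have conv: "is_union_of (r\<inverse>) Z" if "is_union_of r Z" "good Z" for r Z
  proof -
    obtain T where "T \<subseteq> Z" "r = \<Union>T" using \<open>is_union_of r Z\<close> by (auto simp: is_union_of_def)
    then have "converse ` T \<subseteq> Z" "r\<inverse> = \<Union> (converse ` T)"
      using goodcc[OF \<open>good Z\<close>] by (auto simp: coherent_configuration_def)
    then show ?thesis unfolding is_union_of_def by blast
  qed
  have convE: "(prod.swap p, prod.swap q) \<in> E" if "(p, q) \<in> E" for p q
  proof -
    have "(p, q) \<in> ?W\<^sup>*" using that by (simp add: E_def)
    then have "(prod.swap p, prod.swap q) \<in> ?W\<^sup>*"
    proof (induction rule: rtrancl_induct)
      case (step y z)
      from step(2) obtain Z s where "good Z" "s \<in> Z" "y \<in> s" "z \<in> s"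
        unfolding mem_Collect_eq case_prod_conv by blast
      then have "good Z" "s\<inverse> \<in> Z" "prod.swap y \<in> s\<inverse>" "prod.swap z \<in> s\<inverse>"
        using goodcc[of Z] by (cases y; cases z; auto simp: coherent_configuration_def)+
      then have "(prod.swap y, prod.swap z) \<in> ?W"
        unfolding mem_Collect_eq case_prod_conv by (intro exI[of _ Z] exI[of _ "s\<inverse>"] conjI)
      with step.IH show ?case by (rule rtrancl_into_rtrancl)
    qed simp
    with that show ?thesis by (auto simp: E_def)
  qed
  have convY: "r\<inverse> \<in> Y" if r: "r \<in> Y" for r
  proof -
    obtain p where p: "p \<in> \<Omega> \<times> \<Omega>" "r = E `` {p}"
      using r by (auto simp: Y_def quotient_def)
    have "r\<inverse> = E `` {prod.swap p}"
    proof (intro set_eqI)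
      fix q
      have "q \<in> r\<inverse> \<longleftrightarrow> (p, prod.swap q) \<in> E" using p by (cases q) auto
      also have "\<dots> \<longleftrightarrow> (prod.swap p, q) \<in> E"
        using convE[of p "prod.swap q"] convE[of "prod.swap p" q] by auto
      finally show "q \<in> r\<inverse> \<longleftrightarrow> q \<in> E `` {prod.swap p}" by simp
    qed
    then show ?thesis using p by (auto simp: Y_def intro: quotientI)
  qed
  have "coherent_configuration \<Omega> Y"
    unfolding coherent_configuration_def
  proof (intro conjI ballI fin partY convY)
    show "is_union_of (Id_on \<Omega>) Y"
      using goodcc by (intro union_Y) (auto simp: coherent_configuration_def)
    fix r s t assume rst: "r \<in> Y" "s \<in> Y" "t \<in> Y"
    define f where "f p = card {\<gamma>. (fst p, \<gamma>) \<in> r \<and> (\<gamma>, snd p) \<in> s}" for p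
    have "t \<noteq> {}" using partition_onD3[OF partY] rst(3) by auto
    then obtain p where p: "p \<in> t" by blast
    have "f q = f p" if "q \<in> t" for q
    proof (rule const[OF rst(3) that p])
      fix Z u p q assume Z: "good Z" and u: "u \<in> Z" "p \<in> u" "q \<in> u"
      then show "f p = f q"
        using coherent_union_count[OF goodcc[OF Z] un[OF rst(1) Z] un[OF rst(2) Z] u(1),
            of "fst p" "snd p" "fst q" "snd q"] by (simp add: f_def)
    qed
    then show "\<exists>c. \<forall>(\<alpha>, \<beta>)\<in>t. card {\<gamma>. (\<alpha>, \<gamma>) \<in> r \<and> (\<gamma>, \<beta>) \<in> s} = c"
      by (intro exI[of _ "f p"]) (auto simp: f_def)
  qed
  moreover have "\<forall>R\<in>\<R>. is_union_of R Y"
    using \<R> union_Y by (auto simp: good_def)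
  ultimately show ?thesis using ref unfolding good_def by blast
qed

lemma refines_iff_union:
  assumes P: "partition_on A P" and Q: "partition_on A Q"
  shows "refines A P Q \<longleftrightarrow> (\<forall>R\<in>Q. is_union_of R P)"
proof
  assume ref: "refines A P Q"
  show "\<forall>R\<in>Q. is_union_of R P"
  proof
    fix R assume "R \<in> Q"
    from partition_onD1[OF refines_obtains_subset[OF ref this]] show "is_union_of R P"
      unfolding is_union_of_def by (intro exI[of _ "{p \<in> P. p \<subseteq> R}"]) auto
  qed
next
  assume un: "\<forall>R\<in>Q. is_union_of R P"
  show "refines A P Q"
    unfolding refines_def
  proof (intro conjI ballI P Q)
    fix X assume X: "X \<in> P"
    then have "X \<noteq> {}" "X \<subseteq> A" using P by (auto simp: partition_on_def)
    then obtain x where "x \<in> X" "x \<in> A" by blast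
    moreover then obtain R where "R \<in> Q" "x \<in> R" using Q by (auto simp: partition_on_def)
    ultimately show "\<exists>Y\<in>Q. X \<subseteq> Y" using Union_sub_partition[OF P _ _ X] un by blast
  qed
qed

lemma partition_on_tensor_square:
  assumes "partition_on (\<Omega> \<times> \<Omega>) S"
  shows "partition_on ((\<Omega> \<times> \<Omega>) \<times> (\<Omega> \<times> \<Omega>)) (tensor_square S)"
proof (rule partition_onI)
  have cover: "\<exists>r\<in>S. p \<in> r" if "p \<in> \<Omega> \<times> \<Omega>" for p
    using assms that by (auto simp: partition_on_def)
  have sub: "r \<subseteq> \<Omega> \<times> \<Omega>" if "r \<in> S" for r
    using assms that by (auto simp: partition_on_def)
  show "\<Union> (tensor_square S) = (\<Omega> \<times> \<Omega>) \<times> (\<Omega> \<times> \<Omega>)"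
  proof
    show "\<Union> (tensor_square S) \<subseteq> (\<Omega> \<times> \<Omega>) \<times> \<Omega> \<times> \<Omega>"
      using sub by (fastforce simp: tensor_square_def tensor_rel_def)
    show "(\<Omega> \<times> \<Omega>) \<times> \<Omega> \<times> \<Omega> \<subseteq> \<Union> (tensor_square S)"
    proof clarify
      fix a b c d assume "a \<in> \<Omega>" "b \<in> \<Omega>" "c \<in> \<Omega>" "d \<in> \<Omega>"
      then obtain r s where "r \<in> S" "s \<in> S" "(a, c) \<in> r" "(b, d) \<in> s"
        using cover[of "(a, c)"] cover[of "(b, d)"] by auto
      then show "((a, b), c, d) \<in> \<Union> (tensor_square S)"
        by (intro UnionI[of "tensor_rel r s"]) (auto simp: tensor_square_def tensor_rel_def)
    qed
  qed
  show "disjnt p q" if pq': "p \<in> tensor_square S" "q \<in> tensor_square S" "p \<noteq> q" for p q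
  proof -
    obtain r s r' s' where pq: "r \<in> S" "s \<in> S" "p = tensor_rel r s"
        "r' \<in> S" "s' \<in> S" "q = tensor_rel r' s'"
      using pq'(1,2) unfolding tensor_square_def by blast
    then have "r \<noteq> r' \<or> s \<noteq> s'" using pq' by auto
    then have "r \<inter> r' = {} \<or> s \<inter> s' = {}"
      using pq assms by (auto simp: partition_on_def disjoint_def)
    then show ?thesis using pq by (auto simp: disjnt_iff tensor_rel_def)
  qed
  show "{} \<notin> tensor_square S"
  proof
    assume "{} \<in> tensor_square S"
    then obtain r s where rs: "r \<in> S" "s \<in> S" "tensor_rel r s = {}"
      by (auto simp: tensor_square_def)
    then obtain a b c d where "(a, b) \<in> r" "(c, d) \<in> s"
      using assms unfolding partition_on_def by (metis ex_in_conv surj_pair)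
    then have "((a, c), (b, d)) \<in> tensor_rel r s" by (simp add: tensor_rel_def)
    with rs show False by simp
  qed
qed

lemma is_two_extension_two_extension:
  assumes "coherent_configuration \<Omega> S"
  shows "is_two_extension \<Omega> S (two_extension \<Omega> S)"
proof -
  let ?A = "(\<Omega> \<times> \<Omega>) \<times> (\<Omega> \<times> \<Omega>)"
  define \<R> where "\<R> = insert (Id_on (Id_on \<Omega>)) (tensor_square S)"
  have fin: "finite (\<Omega> \<times> \<Omega>)" using assms by (auto simp: coherent_configuration_def)
  have part: "partition_on ?A (tensor_square S)"
    using assms by (intro partition_on_tensor_square) (auto simp: coherent_configuration_def)
  have \<R>: "R \<subseteq> ?A" if "R \<in> \<R>" for R
    using that part by (auto simp: \<R>_def partition_on_def)
  have dfi: "diagonal_fission \<Omega> S Z \<longleftrightarrow>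
      coherent_configuration (\<Omega> \<times> \<Omega>) Z \<and> (\<forall>R\<in>\<R>. is_union_of R Z)" for Z
    unfolding diagonal_fission_def \<R>_def
    using refines_iff_union[OF _ part] by (auto simp: coherent_configuration_def)
  have "\<exists>Y. is_two_extension \<Omega> S Y"
    unfolding is_two_extension_def dfi using coarsest_coherent[OF fin, of \<R>, OF \<R>]
    by (simp only: conj_assoc)
  then obtain Y where Y: "is_two_extension \<Omega> S Y" ..
  have uniq: "Z = Y" if "is_two_extension \<Omega> S Z" for Z
  proof (rule refines_asym)
    show "refines ?A Z Y" "refines ?A Y Z" using that Y unfolding is_two_extension_def by simp_all
  qed
  show ?thesis unfolding two_extension_def by (rule theI, rule Y, rule uniq)
qed

lemma intersection_number_eq:
  assumes "coherent_configuration \<Omega> S" "r \<in> S" "s \<in> S" "t \<in> S" "(\<alpha>, \<beta>) \<in> t"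
  shows "intersection_number r s t = card {\<gamma>. (\<alpha>, \<gamma>) \<in> r \<and> (\<gamma>, \<beta>) \<in> s}"
proof -
  obtain c where c: "\<forall>(\<alpha>, \<beta>)\<in>t. card {\<gamma>. (\<alpha>, \<gamma>) \<in> r \<and> (\<gamma>, \<beta>) \<in> s} = c"
    using assms unfolding coherent_configuration_def by blast
  then have "intersection_number r s t = c"
    unfolding intersection_number_def using assms(5) by (intro the_equality) auto
  then show ?thesis using c assms(5) by auto
qed

text \<open>The 2-orbits of a transitive permutation group form a scheme.\<close>

lemma scheme_orbits:
  assumes fin: "finite \<Omega>" and bij: "\<And>g. g \<in> G \<Longrightarrow> bij_betw g \<Omega> \<Omega>"
    and one: "id \<in> G" and mult: "\<And>g h. g \<in> G \<Longrightarrow> h \<in> G \<Longrightarrow> g \<circ> h \<in> G"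
    and inv: "\<And>g. g \<in> G \<Longrightarrow> \<exists>h\<in>G. \<forall>x\<in>\<Omega>. h (g x) = x"
    and w: "w \<in> \<Omega>" and trans: "\<And>x. x \<in> \<Omega> \<Longrightarrow> \<exists>g\<in>G. g w = x"
  shows "scheme \<Omega> {{(g x, g y) | g. g \<in> G} | x y. x \<in> \<Omega> \<and> y \<in> \<Omega>}"
proof -
  define orb where "orb p = {(g (fst p), g (snd p)) | g. g \<in> G}" for p
  define S where "S = orb ` (\<Omega> \<times> \<Omega>)"
  have S: "{{(g x, g y) | g. g \<in> G} | x y. x \<in> \<Omega> \<and> y \<in> \<Omega>} = S"
  proof -
    have "{(g x, g y) | g. g \<in> G} = orb (x, y)" for x y by (simp add: orb_def)
    then show ?thesis unfolding S_def by auto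
  qed
  have mem: "g x \<in> \<Omega>" if "g \<in> G" "x \<in> \<Omega>" for g x
    using bij[OF that(1)] that(2) by (auto simp: bij_betw_def)
  have self: "p \<in> orb p" for p
    using one by (auto simp: orb_def intro!: exI[of _ id])
  have sub: "orb p \<subseteq> \<Omega> \<times> \<Omega>" if "p \<in> \<Omega> \<times> \<Omega>" for p
    using that mem by (auto simp: orb_def)
  have orb_mono: "orb q \<subseteq> orb p" if q: "q \<in> orb p" for p q
  proof
    obtain h where h: "h \<in> G" "q = (h (fst p), h (snd p))" using q by (auto simp: orb_def)
    fix u assume "u \<in> orb q"
    then obtain g where g: "g \<in> G" "u = (g (fst q), g (snd q))" by (auto simp: orb_def)
    have "u = ((g \<circ> h) (fst p), (g \<circ> h) (snd p))" using g h by simp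
    then show "u \<in> orb p" unfolding orb_def using mult[OF g(1) h(1)] by blast
  qed
  have orb_sym: "p \<in> orb q" if pq: "q \<in> orb p" "p \<in> \<Omega> \<times> \<Omega>" for p q
  proof -
    obtain g where g: "g \<in> G" "q = (g (fst p), g (snd p))" using pq by (auto simp: orb_def)
    obtain h where h: "h \<in> G" "\<forall>x\<in>\<Omega>. h (g x) = x" using inv[OF g(1)] by blast
    have "p = (h (fst q), h (snd q))" using g h pq by auto
    then show ?thesis unfolding orb_def using h by blast
  qed
  have orb_eq: "orb q = orb p" if "q \<in> orb p" "p \<in> \<Omega> \<times> \<Omega>" for p q
    using orb_mono[OF that(1)] orb_mono[OF orb_sym[OF that]] by blast
  have closed: "(g x, g y) \<in> r" if r: "r \<in> S" and xy: "(x, y) \<in> r" and g: "g \<in> G" for r g x y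
  proof -
    obtain p where "r = orb p" using r by (auto simp: S_def)
    moreover have "(g x, g y) \<in> orb (x, y)" using g by (auto simp: orb_def)
    ultimately show ?thesis using orb_mono xy by blast
  qed
  have diag: "orb (w, w) = Id_on \<Omega>"
    using trans mem w by (auto simp: orb_def Id_on_def)
  have DS: "Id_on \<Omega> \<in> S" unfolding S_def diag[symmetric] using w by auto
  have Ssub: "r \<subseteq> \<Omega> \<times> \<Omega>" if "r \<in> S" for r using that sub by (auto simp: S_def)
  have "coherent_configuration \<Omega> S"
    unfolding coherent_configuration_def
  proof (intro conjI ballI fin)
    show "partition_on (\<Omega> \<times> \<Omega>) S"
    proof (rule partition_onI)
      show "\<Union>S = \<Omega> \<times> \<Omega>" unfolding S_def using sub self by blast
      show "{} \<notin> S" using self by (auto simp: S_def)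
      fix r s assume rs: "r \<in> S" "s \<in> S" "r \<noteq> s"
      then obtain p q where pq: "p \<in> \<Omega> \<times> \<Omega>" "q \<in> \<Omega> \<times> \<Omega>" "r = orb p" "s = orb q"
        by (auto simp: S_def)
      then show "disjnt r s" using orb_eq[of _ p] orb_eq[of _ q] rs(3) unfolding disjnt_iff by metis
    qed
    show "is_union_of (Id_on \<Omega>) S"
      unfolding is_union_of_def using DS by (intro exI[of _ "{Id_on \<Omega>}"]) auto
    show "r\<inverse> \<in> S" if r: "r \<in> S" for r
    proof -
      obtain p where p: "p \<in> \<Omega> \<times> \<Omega>" "r = orb p" using r by (auto simp: S_def)
      then have "r\<inverse> = orb (prod.swap p)" by (auto simp: orb_def)
      then show ?thesis using p by (auto simp: S_def)
    qed
    fix r s t assume rst: "r \<in> S" "s \<in> S" "t \<in> S"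
    then obtain p where p: "p \<in> \<Omega> \<times> \<Omega>" "t = orb p" by (auto simp: S_def)
    let ?N = "\<lambda>x y. {\<gamma>. (x, \<gamma>) \<in> r \<and> (\<gamma>, y) \<in> s}"
    have "card (?N x y) = card (?N (fst p) (snd p))" if xy: "(x, y) \<in> t" for x y
    proof -
      obtain g where g: "g \<in> G" "x = g (fst p)" "y = g (snd p)"
        using xy p by (auto simp: orb_def)
      obtain h where h: "h \<in> G" "\<forall>x\<in>\<Omega>. h (g x) = x" using inv[OF g(1)] by blast
      have gh: "g (h z) = z" if "z \<in> \<Omega>" for z
        using bij_betw_imp_surj_on[OF bij[OF g(1)]] h(2) that by (metis imageE)
      have inj: "inj_on g (?N (fst p) (snd p))"
        using bij[OF g(1)] Ssub[OF rst(1)] unfolding bij_betw_def by (auto intro: inj_on_subset)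
      have "g ` ?N (fst p) (snd p) = ?N x y"
      proof
        show "g ` ?N (fst p) (snd p) \<subseteq> ?N x y"
          using closed[OF rst(1) _ g(1)] closed[OF rst(2) _ g(1)] g by auto
        show "?N x y \<subseteq> g ` ?N (fst p) (snd p)"
        proof
          fix z assume z: "z \<in> ?N x y"
          then have "z = g (h z)" using gh Ssub[OF rst(1)] by auto
          moreover have "h z \<in> ?N (h x) (h y)"
            using closed[OF rst(1) _ h(1)] closed[OF rst(2) _ h(1)] z by auto
          moreover have "h x = fst p" "h y = snd p" using g h p by auto
          ultimately show "z \<in> g ` ?N (fst p) (snd p)" by (simp only: image_eqI)
        qed
      qed
      then show ?thesis using card_image[OF inj] by simp
    qed
    then show "\<exists>c. \<forall>(\<alpha>, \<beta>)\<in>t. card (?N \<alpha> \<beta>) = c" by auto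
  qed
  with DS show ?thesis unfolding S scheme_def by blast
qed

lemma field_automorphism_fix:
  assumes "\<sigma> \<in> field_automorphisms"
  shows "\<sigma> 0 = 0" "\<sigma> 1 = 1" "\<sigma> x = 0 \<longleftrightarrow> x = 0"
proof -
  have bij: "bij \<sigma>" and add: "\<sigma> (x + y) = \<sigma> x + \<sigma> y" and mult: "\<sigma> (x * y) = \<sigma> x * \<sigma> y" for x y
    using assms by (auto simp: field_automorphisms_def)
  have "\<sigma> 0 + 0 = \<sigma> 0 + \<sigma> 0" using add[of 0 0] by simp
  then show z: "\<sigma> 0 = 0" by (metis add_left_cancel)
  have nz: "\<sigma> x = 0 \<longleftrightarrow> x = 0" for x
    using bij_is_inj[OF bij] z by (metis injD)
  then show "\<sigma> x = 0 \<longleftrightarrow> x = 0" .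
  show "\<sigma> 1 = 1" using mult[of 1 1] nz[of 1] by simp
qed

lemma scheme_C_basis:
  assumes "finite (UNIV :: 'a::field set)"
  shows "scheme (UNIV - {0 :: 'a}) C_basis"
proof -
  define G :: "('a \<Rightarrow> 'a) set" where
    "G = {\<lambda>x. a * \<sigma> x | a \<sigma>. a \<noteq> 0 \<and> \<sigma> \<in> field_automorphisms}"
  have C: "C_basis = {{(g x, g y) | g. g \<in> G} | x y. x \<in> UNIV - {0} \<and> y \<in> UNIV - {0}}"
  proof -
    have "{(a * \<sigma> x, a * \<sigma> y) | a \<sigma>. a \<noteq> 0 \<and> \<sigma> \<in> field_automorphisms} =
        {(g x, g y) | g. g \<in> G}" for x y :: 'a
    proof (intro equalityI subsetI)
      fix p assume "p \<in> {(a * \<sigma> x, a * \<sigma> y) | a \<sigma>. a \<noteq> 0 \<and> \<sigma> \<in> field_automorphisms}"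
      then obtain a \<sigma> where p: "p = (a * \<sigma> x, a * \<sigma> y)" "a \<noteq> 0" "\<sigma> \<in> field_automorphisms"
        by blast
      have "(\<lambda>x. a * \<sigma> x) \<in> G" using p unfolding G_def by blast
      then show "p \<in> {(g x, g y) | g. g \<in> G}"
        using p unfolding mem_Collect_eq by (intro exI[of _ "\<lambda>x. a * \<sigma> x"]) simp
    next
      fix p assume "p \<in> {(g x, g y) | g. g \<in> G}"
      then show "p \<in> {(a * \<sigma> x, a * \<sigma> y) | a \<sigma>. a \<noteq> 0 \<and> \<sigma> \<in> field_automorphisms}"
        unfolding G_def by auto
    qed
    then show ?thesis unfolding C_basis_def by simp
  qed
  have comp: "\<sigma> \<circ> \<tau> \<in> field_automorphisms"
    if "\<sigma> \<in> field_automorphisms" "\<tau> \<in> field_automorphisms" for \<sigma> \<tau> :: "'a \<Rightarrow> 'a"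
    using that by (auto simp: field_automorphisms_def intro: bij_comp)
  have one: "id \<in> (field_automorphisms :: ('a \<Rightarrow> 'a) set)"
    by (auto simp: field_automorphisms_def)
  have inv: "inv \<sigma> \<in> field_automorphisms" if "\<sigma> \<in> field_automorphisms" for \<sigma> :: "'a \<Rightarrow> 'a"
  proof -
    have bij: "bij \<sigma>" and add: "\<And>x y. \<sigma> (x + y) = \<sigma> x + \<sigma> y"
      and mult: "\<And>x y. \<sigma> (x * y) = \<sigma> x * \<sigma> y"
      using that by (auto simp: field_automorphisms_def)
    have r: "\<sigma> (inv \<sigma> x) = x" and l: "inv \<sigma> (\<sigma> x) = x" for x
      using bij by (simp_all add: bij_is_surj surj_f_inv_f bij_is_inj)
    have "inv \<sigma> (x + y) = inv \<sigma> x + inv \<sigma> y" "inv \<sigma> (x * y) = inv \<sigma> x * inv \<sigma> y" for x y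
      using l[of "inv \<sigma> x + inv \<sigma> y"] l[of "inv \<sigma> x * inv \<sigma> y"] by (simp_all add: add mult r)
    then show ?thesis using bij by (auto simp: field_automorphisms_def bij_imp_bij_inv)
  qed
  show ?thesis
    unfolding C
  proof (rule scheme_orbits[where w = 1])
    show "finite (UNIV - {0 :: 'a})" using assms by simp
    have scale: "(\<lambda>x. a * x) \<in> G" if "a \<noteq> 0" for a
      using one that unfolding G_def mem_Collect_eq by (intro exI[of _ a] exI[of _ id]) simp
    show "id \<in> G" using scale[of 1] by (simp add: id_def)
    show "(1 :: 'a) \<in> UNIV - {0}" by simp
    show "\<exists>g\<in>G. g 1 = x" if "x \<in> UNIV - {0}" for x :: 'a
      using that scale[of x] by (intro bexI[of _ "\<lambda>z. x * z"]) auto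
    fix g assume "g \<in> G"
    then obtain a \<sigma> where g: "g = (\<lambda>x. a * \<sigma> x)" "a \<noteq> 0" "\<sigma> \<in> field_automorphisms"
      by (auto simp: G_def)
    have bij: "bij \<sigma>" and mult: "\<And>x y. \<sigma> (x * y) = \<sigma> x * \<sigma> y"
      using g by (auto simp: field_automorphisms_def)
    have r: "\<sigma> (inv \<sigma> x) = x" and l: "inv \<sigma> (\<sigma> x) = x" for x
      using bij by (simp_all add: bij_is_surj surj_f_inv_f bij_is_inj)
    note fix\<sigma> = field_automorphism_fix[OF g(3)] and fixi = field_automorphism_fix[OF inv[OF g(3)]]
    show "bij_betw g (UNIV - {0}) (UNIV - {0})"
    proof (rule bij_betw_byWitness[where f' = "\<lambda>x. inv \<sigma> (x / a)"])
    qed (use g l r fix\<sigma> fixi in auto)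
    have "(\<lambda>x. inv \<sigma> (inverse a) * inv \<sigma> x) \<in> G"
      using g(2) inv[OF g(3)] fixi(3) unfolding G_def mem_Collect_eq
      by (intro exI[of _ "inv \<sigma> (inverse a)"] exI[of _ "inv \<sigma>"]) simp
    moreover have "inv \<sigma> (inverse a) * inv \<sigma> (g x) = x" for x
    proof -
      have "inv \<sigma> (inverse a) * inv \<sigma> (g x) = inv \<sigma> (inverse a * (a * \<sigma> x))"
        using inv[OF g(3)] g(1) by (auto simp: field_automorphisms_def)
      then show ?thesis using g(2) l by (simp add: mult.assoc[symmetric])
    qed
    ultimately show "\<exists>h\<in>G. \<forall>x\<in>UNIV - {0}. h (g x) = x"
      by (intro bexI[of _ "\<lambda>x. inv \<sigma> (inverse a) * inv \<sigma> x"]) simp_all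
    fix h assume "h \<in> G"
    then obtain b \<tau> where h: "h = (\<lambda>x. b * \<tau> x)" "b \<noteq> 0" "\<tau> \<in> field_automorphisms"
      by (auto simp: G_def)
    have "g \<circ> h = (\<lambda>x. (a * \<sigma> b) * (\<sigma> \<circ> \<tau>) x)"
      using g h mult by (auto simp: fun_eq_iff mult.assoc)
    moreover have "a * \<sigma> b \<noteq> 0" using g h fix\<sigma> by auto
    ultimately show "g \<circ> h \<in> G"
      unfolding G_def mem_Collect_eq using comp[OF g(3) h(3)]
      by (intro exI[of _ "a * \<sigma> b"] exI[of _ "\<sigma> \<circ> \<tau>"]) simp
  qed
qed

lemma scheme_cyclotomic_basis:
  assumes fin: "finite (UNIV :: 'a::field set)" and M: "mult_subgroup (M :: 'a set)"
  shows "scheme UNIV (cyclotomic_basis M)"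
proof -
  define G :: "('a \<Rightarrow> 'a) set" where "G = {\<lambda>x. m * x + b | m b. m \<in> M}"
  have nz: "m \<noteq> 0" if "m \<in> M" for m using M that by (auto simp: mult_subgroup_def)
  have orb: "{(g x, g y) | g. g \<in> G} = {(u, v). v - u \<in> (\<lambda>m. m * (y - x)) ` M}" for x y
  proof (intro set_eqI iffI)
    fix p assume "p \<in> {(g x, g y) | g. g \<in> G}"
    then show "p \<in> {(u, v). v - u \<in> (\<lambda>m. m * (y - x)) ` M}"
      by (auto simp: G_def algebra_simps)
  next
    fix p assume "p \<in> {(u, v). v - u \<in> (\<lambda>m. m * (y - x)) ` M}"
    then obtain u v m where p: "p = (u, v)" "m \<in> M" "v - u = m * (y - x)" by auto
    let ?g = "\<lambda>z. m * z + (u - m * x)"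
    have "?g \<in> G" using p by (auto simp: G_def)
    moreover have "p = (?g x, ?g y)" using p by (auto simp: algebra_simps)
    ultimately show "p \<in> {(g x, g y) | g. g \<in> G}"
      unfolding mem_Collect_eq by (intro exI[of _ ?g] conjI)
  qed
  have C: "cyclotomic_basis M = {{(g x, g y) | g. g \<in> G} | x y. x \<in> UNIV \<and> y \<in> UNIV}"
  proof -
    have "{F a | a. True} = {F (y - x) | x y. x \<in> UNIV \<and> y \<in> UNIV}"
      for F :: "'a \<Rightarrow> ('a \<times> 'a) set"
    proof (intro equalityI subsetI)
      fix R assume "R \<in> {F a | a. True}"
      then obtain a where "R = F (a - 0)" by auto
      then show "R \<in> {F (y - x) | x y. x \<in> UNIV \<and> y \<in> UNIV}" by blast
    qed auto
    then show ?thesis unfolding orb cyclotomic_basis_def .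
  qed
  show ?thesis
    unfolding C
  proof (rule scheme_orbits[where w = 0])
    have "1 \<in> M" using M by (auto simp: mult_subgroup_def)
    then have shift: "(\<lambda>x. x + b) \<in> G" for b
      unfolding G_def mem_Collect_eq by (intro exI[of _ 1] exI[of _ b]) simp
    show "id \<in> G" using shift[of 0] by (simp add: id_def)
    show "\<exists>g\<in>G. g 0 = x" for x using shift[of x] by (intro bexI[of _ "\<lambda>z. z + x"]) simp_all
    fix g assume "g \<in> G"
    then obtain m b where g: "g = (\<lambda>x. m * x + b)" "m \<in> M" by (auto simp: G_def)
    show "bij g"
      by (rule bij_betw_byWitness[where f' = "\<lambda>x. (x - b) / m"]) (use g nz in auto)
    have "inverse m \<in> M" using M g by (auto simp: mult_subgroup_def)
    then have "(\<lambda>x. inverse m * x + (- inverse m * b)) \<in> G" unfolding G_def by blast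
    moreover have "inverse m * g x + (- inverse m * b) = x" for x
      using g nz by (simp add: field_simps)
    ultimately show "\<exists>h\<in>G. \<forall>x\<in>UNIV. h (g x) = x"
      by (intro bexI[of _ "\<lambda>x. inverse m * x + (- inverse m * b)"]) simp_all
    fix h assume "h \<in> G"
    then obtain n c where h: "h = (\<lambda>x. n * x + c)" "n \<in> M" by (auto simp: G_def)
    have "g \<circ> h = (\<lambda>x. (m * n) * x + (m * c + b))"
      using g h by (auto simp: fun_eq_iff algebra_simps)
    moreover have "m * n \<in> M" using M g h by (auto simp: mult_subgroup_def)
    ultimately show "g \<circ> h \<in> G" unfolding G_def by blast
  qed (use fin in auto)
qed

end

theory Submission
  imports Defs "HOL-Library.Code_Binary_Nat"
    "HOL-Computational_Algebra.Polynomial" "HOL-Computational_Algebra.Primes"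
begin

text \<open>An algebraic isomorphism is turned into an isomorphism by mapping one point after the other. A
  partial map that respects the basis relations is extended to a new point \<open>u\<close> by choosing an image
  \<open>u'\<close> with the correct relations to two points already mapped. The intersection numbers then restrict
  the relation of \<open>u'\<close> to each further point \<open>z\<close>: by counting the paths from a point \<open>w\<close> to \<open>z\<close>, it is
  the relation to \<open>z\<close> of some point \<open>v\<close> that is not yet mapped and has the same relation to \<open>w\<close> as
  \<open>u\<close>. For \<open>C(p\<^sup>d)\<close>, which is the scheme on \<open>\<int>/(p\<^sup>d - 1)\<close> given by the orbits of multiplication by
  \<open>p\<close>, these restrictions always leave a single possibility if the points are taken in a suitable
  order.

  For a cyclotomic scheme, the same extension procedure is applied to the 2-extension. It works as soon
  as there are points \<open>a\<close>, \<open>b\<close>, \<open>c\<close> such that \<open>x\<close> is determined by the basis relation of the 2-extension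
  that contains \<open>((a, b), (c, x))\<close>. If \<open>M\<close> is a proper subgroup, it consists of \<open>m\<close>-th powers for
  some prime \<open>m\<close>, and one round of colour refinement shows that \<open>0\<close>, \<open>1\<close> and a primitive element are
  such points. Otherwise the scheme has rank two.\<close>

section \<open>Extending partial isomorphisms along an algebraic isomorphism\<close>

text \<open>One direction suffices: basis relations partition the pairs and \<open>\<phi>\<close> is
  injective on them, so on points of \<open>\<Omega>\<close> images determine relations too
  (\<open>faithful_rev\<close>).\<close>

definition faithful ::
    "('a \<times> 'a) set set \<Rightarrow> (('a \<times> 'a) set \<Rightarrow> ('b \<times> 'b) set) \<Rightarrow> 'a set \<Rightarrow> ('a \<Rightarrow> 'b) \<Rightarrow> bool" where
  "faithful S \<phi> Z g \<longleftrightarrow> (\<forall>x\<in>Z. \<forall>y\<in>Z. \<forall>s\<in>S. (x, y) \<in> s \<longrightarrow> (g x, g y) \<in> \<phi> s)"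

locale coherent =
  fixes \<Omega> :: "'a set" and S :: "('a \<times> 'a) set set"
  assumes cc: "coherent_configuration \<Omega> S"
begin

lemma finite_points: "finite \<Omega>"
  using cc by (simp add: coherent_configuration_def)

lemma part: "partition_on (\<Omega> \<times> \<Omega>) S"
  using cc by (simp add: coherent_configuration_def)

lemma basis_subset: "s \<in> S \<Longrightarrow> s \<subseteq> \<Omega> \<times> \<Omega>"
  using part by (auto simp: partition_on_def)

lemma basis_points: "s \<in> S \<Longrightarrow> (x, y) \<in> s \<Longrightarrow> x \<in> \<Omega> \<and> y \<in> \<Omega>"
  using basis_subset by blast

lemma basis_cover: "x \<in> \<Omega> \<Longrightarrow> y \<in> \<Omega> \<Longrightarrow> \<exists>s\<in>S. (x, y) \<in> s"
  using part by (auto simp: partition_on_def)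

lemma basis_unique: "r \<in> S \<Longrightarrow> s \<in> S \<Longrightarrow> p \<in> r \<Longrightarrow> p \<in> s \<Longrightarrow> r = s"
  using part by (auto simp: partition_on_def disjoint_def)

lemma basis_nonempty: "s \<in> S \<Longrightarrow> \<exists>x y. (x, y) \<in> s"
  using part by (auto simp: partition_on_def) (metis ex_in_conv surj_pair)

lemma basis_converse: "s \<in> S \<Longrightarrow> s\<inverse> \<in> S"
  using cc by (simp add: coherent_configuration_def)

lemma basis_diagonal:
  assumes "t \<in> S" "(x, x) \<in> t" "(y, z) \<in> t"
  shows "y = z"
proof -
  have "is_union_of (Id_on \<Omega>) S" using cc by (simp add: coherent_configuration_def)
  moreover have "(x, x) \<in> Id_on \<Omega>" using basis_points assms by auto
  ultimately have "t \<subseteq> Id_on \<Omega>" using Union_sub_partition[OF part] assms by blast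
  then show ?thesis using assms by auto
qed

lemma finite_paths:
  assumes "r \<in> S" shows "finite {z. (x, z) \<in> r \<and> (z, y) \<in> s}"
  by (rule finite_subset[OF _ finite_points]) (use basis_subset[OF assms] in auto)

end

section \<open>Images of basis relations under an algebraic isomorphism\<close>

locale alg_iso = X: coherent \<Omega> S + X': coherent \<Omega>' S'
  for \<Omega> :: "'a set" and S and \<Omega>' :: "'b set" and S' +
  fixes \<phi> :: "('a \<times> 'a) set \<Rightarrow> ('b \<times> 'b) set"
  assumes iso: "algebraic_isomorphism S S' \<phi>"
begin

lemma image_basis: "s \<in> S \<Longrightarrow> \<phi> s \<in> S'"
  using iso by (auto simp: algebraic_isomorphism_def bij_betw_def)

lemma image_inj: "r \<in> S \<Longrightarrow> s \<in> S \<Longrightarrow> \<phi> r = \<phi> s \<Longrightarrow> r = s"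
  using iso by (auto simp: algebraic_isomorphism_def bij_betw_def inj_on_def)

lemma image_unique: "r \<in> S \<Longrightarrow> s \<in> S \<Longrightarrow> p \<in> \<phi> r \<Longrightarrow> p \<in> \<phi> s \<Longrightarrow> r = s"
  using image_inj image_basis X'.basis_unique by metis

lemma image_cover:
  assumes "x \<in> \<Omega>'" "y \<in> \<Omega>'"
  shows "\<exists>s\<in>S. (x, y) \<in> \<phi> s"
proof -
  obtain s' where "s' \<in> S'" "(x, y) \<in> s'" using X'.basis_cover assms by blast
  moreover have "\<phi> ` S = S'" using iso by (auto simp: algebraic_isomorphism_def bij_betw_def)
  ultimately show ?thesis by blast
qed

lemma image_points: "s \<in> S \<Longrightarrow> (x, y) \<in> \<phi> s \<Longrightarrow> x \<in> \<Omega>' \<and> y \<in> \<Omega>'"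
  using X'.basis_points image_basis by blast

lemma paths_eq:
  assumes "r \<in> S" "s \<in> S" "t \<in> S" "(x, y) \<in> t" "(x', y') \<in> \<phi> t"
  shows "card {z. (x, z) \<in> r \<and> (z, y) \<in> s} = card {z. (x', z) \<in> \<phi> r \<and> (z, y') \<in> \<phi> s}"
  using intersection_number_eq[OF X.cc assms(1-4)]
    intersection_number_eq[OF X'.cc image_basis[OF assms(1)] image_basis[OF assms(2)]
      image_basis[OF assms(3)] assms(5)] assms(1-3) iso
  by (simp add: algebraic_isomorphism_def)

lemma path_iff:
  assumes "r \<in> S" "s \<in> S" "t \<in> S" "(x, y) \<in> t" "(x', y') \<in> \<phi> t"
  shows "(\<exists>z. (x, z) \<in> r \<and> (z, y) \<in> s) \<longleftrightarrow> (\<exists>z. (x', z) \<in> \<phi> r \<and> (z, y') \<in> \<phi> s)"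
proof -
  have fin: "finite {z. (x, z) \<in> r \<and> (z, y) \<in> s}" "finite {z. (x', z) \<in> \<phi> r \<and> (z, y') \<in> \<phi> s}"
    by (rule X.finite_paths[OF assms(1)], rule X'.finite_paths[OF image_basis[OF assms(1)]])
  have "{z. (x, z) \<in> r \<and> (z, y) \<in> s} = {} \<longleftrightarrow> {z. (x', z) \<in> \<phi> r \<and> (z, y') \<in> \<phi> s} = {}"
    by (simp only: card_0_eq[OF fin(1), symmetric] card_0_eq[OF fin(2), symmetric] paths_eq[OF assms])
  then show ?thesis unfolding Collect_empty_eq by blast
qed

text \<open>Let \<open>\<phi> d\<close> contain the loop at \<open>x'\<close>. Following this loop
  and then going to \<open>y'\<close> pulls back to a path from \<open>x\<close> to itself through
  \<open>d\<close> and the diagonal \<open>t\<close>; hence \<open>d = t\<close>, so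
  \<open>\<phi> t\<close> contains a loop.\<close>

lemma image_diagonal:
  assumes t: "t \<in> S" "(x, x) \<in> t" and xy': "(x', y') \<in> \<phi> t"
  shows "x' = y'"
proof -
  obtain d where d: "d \<in> S" "(x', x') \<in> \<phi> d"
    using image_cover image_points[OF t(1) xy'] by blast
  have "\<exists>z. (x', z) \<in> \<phi> d \<and> (z, y') \<in> \<phi> t" using d xy' by blast
  then obtain z where "(x, z) \<in> d" "(z, x) \<in> t"
    unfolding path_iff[OF d(1) t(1) t(1) t(2) xy', symmetric] by blast
  moreover from this(2) have "z = x" by (rule X.basis_diagonal[OF t])
  ultimately have "d = t" using X.basis_unique[OF d(1) t(1)] t(2) by blast
  with xy' have "(x', y') \<in> \<phi> d" by simp
  then show ?thesis by (rule X'.basis_diagonal[OF image_basis[OF d(1)] d(2)])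
qed

text \<open>A closed path through \<open>r\<close> and back is carried to one at \<open>u\<close>.
  So \<open>\<phi> (r\<inverse>)\<close> meets \<open>(\<phi> r)\<inverse>\<close>, and both are
  basis relations.\<close>

lemma image_converse:
  assumes r: "r \<in> S" and xy': "(x', y') \<in> \<phi> r"
  shows "(y', x') \<in> \<phi> (r\<inverse>)"
proof -
  obtain x y where xy: "(x, y) \<in> r" using X.basis_nonempty[OF r] by blast
  obtain t where t: "t \<in> S" "(x, x) \<in> t" using X.basis_cover X.basis_points[OF r xy] by blast
  obtain u v where "(u, v) \<in> \<phi> t" using X'.basis_nonempty image_basis[OF t(1)] by blast
  with image_diagonal[OF t this] have u: "(u, u) \<in> \<phi> t" by simp
  have "\<exists>z. (x, z) \<in> r \<and> (z, x) \<in> r\<inverse>" using xy by blast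
  then obtain z where z: "(u, z) \<in> \<phi> r" "(z, u) \<in> \<phi> (r\<inverse>)"
    unfolding path_iff[OF r X.basis_converse[OF r] t u] by blast
  have "\<phi> (r\<inverse>) = (\<phi> r)\<inverse>"
    by (rule X'.basis_unique[OF image_basis[OF X.basis_converse[OF r]]
        X'.basis_converse[OF image_basis[OF r]] z(2)]) (use z(1) in blast)
  then show ?thesis using xy' by blast
qed

lemma image_left_diagonal:
  assumes s: "s \<in> S" "(x, y) \<in> s" "(x', y') \<in> \<phi> s" and t: "t \<in> S" "(x, x) \<in> t"
  shows "(x', x') \<in> \<phi> t"
proof -
  have "\<exists>z. (x, z) \<in> t \<and> (z, y) \<in> s" using t(2) s(2) by blast
  then obtain z where "(x', z) \<in> \<phi> t" "(z, y') \<in> \<phi> s"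
    unfolding path_iff[OF t(1) s(1) s] by blast
  then show ?thesis using image_diagonal[OF t, of x' z] by simp
qed

section \<open>Faithful partial maps and their extension by one point\<close>

lemma faithful_rev:
  assumes g: "faithful S \<phi> Z g" "Z \<subseteq> \<Omega>" and "x \<in> Z" "y \<in> Z" "s \<in> S" "(g x, g y) \<in> \<phi> s"
  shows "(x, y) \<in> s"
proof -
  obtain t where t: "t \<in> S" "(x, y) \<in> t" using assms X.basis_cover by blast
  then have "(g x, g y) \<in> \<phi> t" using assms by (auto simp: faithful_def)
  then show ?thesis using image_unique t assms by blast
qed

lemma faithful_inj:
  assumes g: "faithful S \<phi> Z g" "Z \<subseteq> \<Omega>"
  shows "inj_on g Z"
proof (rule inj_onI)
  fix x y assume xy: "x \<in> Z" "y \<in> Z" "g x = g y"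
  obtain t where t: "t \<in> S" "(x, x) \<in> t" using xy g X.basis_cover by blast
  then have "(g x, g y) \<in> \<phi> t" using g xy unfolding faithful_def by metis
  then have "(x, y) \<in> t" by (rule faithful_rev[OF g xy(1,2) t(1)])
  then show "x = y" by (rule X.basis_diagonal[OF t])
qed

text \<open>Counting the intermediate points inside and outside \<open>Z\<close> separately: those inside correspond
  to each other under \<open>g\<close>, so there are equally many outside.\<close>

lemma outside_iff:
  assumes g: "faithful S \<phi> Z g" "Z \<subseteq> \<Omega>" and ab: "a \<in> Z" "b \<in> Z" and rs: "r \<in> S" "s \<in> S"
  shows "(\<exists>v. v \<notin> Z \<and> (a, v) \<in> r \<and> (v, b) \<in> s) \<longleftrightarrow>
    (\<exists>v. v \<notin> g ` Z \<and> (g a, v) \<in> \<phi> r \<and> (v, g b) \<in> \<phi> s)"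
proof -
  define A where "A = {v. (a, v) \<in> r \<and> (v, b) \<in> s}"
  define A' where "A' = {v. (g a, v) \<in> \<phi> r \<and> (v, g b) \<in> \<phi> s}"
  obtain t where t: "t \<in> S" "(a, b) \<in> t" using ab g X.basis_cover by blast
  then have "card A = card A'"
    unfolding A_def A'_def using g ab rs by (intro paths_eq) (auto simp: faithful_def)
  moreover have "g ` (A \<inter> Z) = A' \<inter> g ` Z"
  proof (intro equalityI subsetI)
    show "p \<in> A' \<inter> g ` Z" if "p \<in> g ` (A \<inter> Z)" for p
      using that g ab rs unfolding A_def A'_def faithful_def by blast
    fix p assume "p \<in> A' \<inter> g ` Z"
    then obtain v where v: "v \<in> Z" "p = g v" "(g a, g v) \<in> \<phi> r" "(g v, g b) \<in> \<phi> s"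
      by (auto simp: A'_def)
    then have "v \<in> A"
      using faithful_rev[OF g ab(1) v(1) rs(1)] faithful_rev[OF g v(1) ab(2) rs(2)]
      by (simp add: A_def)
    then show "p \<in> g ` (A \<inter> Z)" using v by blast
  qed
  then have "card (A \<inter> Z) = card (A' \<inter> g ` Z)"
    using card_image[OF inj_on_subset[OF faithful_inj[OF g]], of "A \<inter> Z"] by simp
  moreover have "finite A" "finite A'"
    unfolding A_def A'_def
    by (rule X.finite_paths[OF rs(1)], rule X'.finite_paths[OF image_basis[OF rs(1)]])
  ultimately have "card (A - Z) = card (A' - g ` Z)" "finite (A - Z)" "finite (A' - g ` Z)"
    by (simp_all add: card_Diff_subset_Int)
  then have "A - Z = {} \<longleftrightarrow> A' - g ` Z = {}" by (simp only: card_0_eq[symmetric])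
  then show ?thesis by (auto simp: A_def A'_def)
qed

text \<open>The point \<open>u\<close> itself lies outside \<open>Z\<close> on a path from
  \<open>a\<close> to \<open>b\<close>, so \<open>outside_iff\<close> supplies a
  counterpart.\<close>

lemma extension_candidate:
  assumes g: "faithful S \<phi> Z g" "Z \<subseteq> \<Omega>" and u: "u \<in> \<Omega>" "u \<notin> Z" and ab: "a \<in> Z" "b \<in> Z"
  obtains u' where "u' \<in> \<Omega>'" "u' \<notin> g ` Z"
    and "\<And>r. r \<in> S \<Longrightarrow> (a, u) \<in> r \<Longrightarrow> (g a, u') \<in> \<phi> r"
    and "\<And>s. s \<in> S \<Longrightarrow> (u, b) \<in> s \<Longrightarrow> (u', g b) \<in> \<phi> s"
proof -
  obtain r s where rs: "r \<in> S" "(a, u) \<in> r" "s \<in> S" "(u, b) \<in> s"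
    using X.basis_cover u ab g by (metis subsetD)
  then have "\<exists>v. v \<notin> Z \<and> (a, v) \<in> r \<and> (v, b) \<in> s" using u by blast
  then obtain u' where u': "u' \<notin> g ` Z" "(g a, u') \<in> \<phi> r" "(u', g b) \<in> \<phi> s"
    unfolding outside_iff[OF g ab rs(1,3)] by blast
  show ?thesis
  proof (rule that)
    show "u' \<in> \<Omega>'" using image_points rs u' by blast
    show "(g a, u') \<in> \<phi> r'" if "r' \<in> S" "(a, u) \<in> r'" for r'
      using X.basis_unique[OF rs(1) that(1) rs(2) that(2)] u' by simp
    show "(u', g b) \<in> \<phi> s'" if "s' \<in> S" "(u, b) \<in> s'" for s'
      using X.basis_unique[OF rs(3) that(1) rs(4) that(2)] u' by simp
  qed (use u' in auto)
qed

text \<open>Now \<open>u'\<close> is the outside point, between \<open>g w\<close> and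
  \<open>g z\<close>, and \<open>outside_iff\<close> is read backwards. This limits the unknown
  relation of \<open>u'\<close> to \<open>g z\<close> to those realised by points \<open>v\<close>
  outside \<open>Z\<close>.\<close>

lemma candidate_relation:
  assumes g: "faithful S \<phi> Z g" "Z \<subseteq> \<Omega>" and u': "u' \<in> \<Omega>'" "u' \<notin> g ` Z" and wz: "w \<in> Z" "z \<in> Z"
    and r: "r \<in> S" "(g w, u') \<in> \<phi> r"
  obtains v where "v \<in> \<Omega>" "v \<notin> Z" "(w, v) \<in> r"
    and "\<And>t. t \<in> S \<Longrightarrow> (v, z) \<in> t \<longleftrightarrow> (u', g z) \<in> \<phi> t"
proof -
  obtain s where "s \<in> S" "(z, z) \<in> s" using wz g X.basis_cover by blast
  then have "g z \<in> \<Omega>'" using image_points g wz unfolding faithful_def by blast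
  then obtain t where t: "t \<in> S" "(u', g z) \<in> \<phi> t" using image_cover u' by blast
  then have "\<exists>v. v \<notin> g ` Z \<and> (g w, v) \<in> \<phi> r \<and> (v, g z) \<in> \<phi> t" using u' r by blast
  then obtain v where v: "v \<notin> Z" "(w, v) \<in> r" "(v, z) \<in> t"
    unfolding outside_iff[OF g wz r(1) t(1), symmetric] by blast
  show ?thesis
  proof (rule that[OF _ v(1,2)])
    show "v \<in> \<Omega>" using X.basis_points r v by blast
    show "(v, z) \<in> t' \<longleftrightarrow> (u', g z) \<in> \<phi> t'" if "t' \<in> S" for t'
    proof
      show "(u', g z) \<in> \<phi> t'" if "(v, z) \<in> t'"
        using X.basis_unique[OF \<open>t' \<in> S\<close> t(1) that v(3)] t by simp
      show "(v, z) \<in> t'" if "(u', g z) \<in> \<phi> t'"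
        using image_unique[OF \<open>t' \<in> S\<close> t(1) that t(2)] v by simp
    qed
  qed
qed

text \<open>Relations towards \<open>u\<close> follow by \<open>image_converse\<close>, and the loop
  at \<open>u\<close> by \<open>image_left_diagonal\<close> from the pair
  \<open>(u, a)\<close>.\<close>

lemma faithful_insert:
  assumes g: "faithful S \<phi> Z g" and Z: "Z \<subseteq> \<Omega>" "a \<in> Z" and u: "u \<in> \<Omega>" "u \<notin> Z"
    and rel: "\<And>z s. z \<in> Z \<Longrightarrow> s \<in> S \<Longrightarrow> (u, z) \<in> s \<Longrightarrow> (u', g z) \<in> \<phi> s"
  shows "faithful S \<phi> (insert u Z) (g(u := u'))"
proof -
  have "(g z, u') \<in> \<phi> s" if "z \<in> Z" "s \<in> S" "(z, u) \<in> s" for z s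
    using image_converse[OF X.basis_converse rel[of z "s\<inverse>"]] X.basis_converse that by simp
  moreover have "(u', u') \<in> \<phi> t" if "t \<in> S" "(u, u) \<in> t" for t
  proof -
    obtain s where "s \<in> S" "(u, a) \<in> s" using X.basis_cover u Z by blast
    then show ?thesis using image_left_diagonal[OF _ _ rel that] Z by blast
  qed
  ultimately show ?thesis using g rel u by (auto simp: faithful_def)
qed

lemma faithful_singleton:
  assumes "a \<in> \<Omega>"
  obtains g where "faithful S \<phi> {a} g"
proof -
  obtain t where t: "t \<in> S" "(a, a) \<in> t" using assms X.basis_cover by blast
  obtain u v where "(u, v) \<in> \<phi> t" using X'.basis_nonempty image_basis[OF t(1)] by blast
  with image_diagonal[OF t this] have "(u, u) \<in> \<phi> t" by simp
  then have "faithful S \<phi> {a} (\<lambda>_. u)"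
    using X.basis_unique[OF t(1) _ t(2)] unfolding faithful_def by blast
  then show ?thesis by (rule that)
qed

lemma faithful_induces:
  assumes g: "faithful S \<phi> \<Omega> g" and ne: "\<Omega> \<noteq> {}"
  shows "isomorphism \<Omega> S \<Omega>' S' g \<and> induced_by S \<phi> g"
proof -
  have inj: "inj_on g \<Omega>" using faithful_inj[OF g] by simp
  obtain a where a: "a \<in> \<Omega>" using ne by blast
  have ga: "g x \<in> \<Omega>'" if "x \<in> \<Omega>" for x
    using X.basis_cover[OF that that] g image_points that unfolding faithful_def by blast
  \<comment> \<open>A point missed by \<open>g\<close> would, by \<open>candidate_relation\<close>
    with \<open>Z = \<Omega>\<close>, yield a point \<open>v\<close> of \<open>\<Omega>\<close>
    outside \<open>\<Omega>\<close>.\<close>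
  have "x' \<in> g ` \<Omega>" if x': "x' \<in> \<Omega>'" for x'
  proof (rule ccontr)
    assume "x' \<notin> g ` \<Omega>"
    obtain r where r: "r \<in> S" "(g a, x') \<in> \<phi> r" using image_cover ga[OF a] x' by blast
    then show False
      using candidate_relation[OF g _ x' \<open>x' \<notin> g ` \<Omega>\<close> a a r] by blast
  qed
  then have bij: "bij_betw g \<Omega> \<Omega>'" using inj ga by (auto simp: bij_betw_def)
  have img: "\<phi> s = map_prod g g ` s" if s: "s \<in> S" for s
  proof
    show "\<phi> s \<subseteq> map_prod g g ` s"
    proof
      fix p assume p: "p \<in> \<phi> s"
      then have "fst p \<in> g ` \<Omega>" "snd p \<in> g ` \<Omega>"
        using image_points[OF s, of "fst p" "snd p"] bij by (auto simp: bij_betw_def)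
      then obtain x y where xy: "x \<in> \<Omega>" "y \<in> \<Omega>" "p = (g x, g y)" by (metis imageE prod.collapse)
      then have "(x, y) \<in> s" using faithful_rev[OF g _ xy(1,2) s] p by simp
      then show "p \<in> map_prod g g ` s" using xy by force
    qed
    show "map_prod g g ` s \<subseteq> \<phi> s"
      using g X.basis_points[OF s] s by (fastforce simp: faithful_def)
  qed
  then have "induced_by S \<phi> g" by (simp add: induced_by_def)
  moreover have "(\<lambda>s. map_prod g g ` s) ` S = \<phi> ` S" using img by (intro image_cong) auto
  then have "(\<lambda>s. map_prod g g ` s) ` S = S'"
    using iso by (simp add: algebraic_isomorphism_def bij_betw_def)
  ultimately show ?thesis using bij by (simp add: isomorphism_def)
qed

end

section \<open>Reconstructing a scheme from three points at a time\<close>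

text \<open>\<open>R i j\<close> names the basis relation of the points \<open>i\<close> and \<open>j\<close>, and \<open>N w u\<close> lists the points that
  are related to \<open>w\<close> as \<open>u\<close> is. \<open>Z\<close> consists of the points already mapped, and \<open>K\<close> of those among
  them whose image is known to have the correct relation to the image of the new point \<open>u\<close>.\<close>

definition settled ::
    "(nat \<Rightarrow> nat \<Rightarrow> nat) \<Rightarrow> (nat \<Rightarrow> nat \<Rightarrow> nat list) \<Rightarrow> nat list \<Rightarrow> nat \<Rightarrow> nat list \<Rightarrow> nat \<Rightarrow> bool" where
  "settled R N Z u K z \<longleftrightarrow>
     list_all (\<lambda>v. List.member Z v \<or> R v z = R u z \<or>
       list_ex (\<lambda>w. list_all (\<lambda>v'. List.member Z v' \<or> R v' z \<noteq> R v z) (N w u)) K) (N 0 u)"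

fun settle ::
    "(nat \<Rightarrow> nat \<Rightarrow> nat) \<Rightarrow> (nat \<Rightarrow> nat \<Rightarrow> nat list) \<Rightarrow> nat list \<Rightarrow> nat \<Rightarrow> nat list \<Rightarrow> nat list \<Rightarrow> nat list" where
  "settle R N Z u K [] = K"
| "settle R N Z u K (z # zs) =
     (if List.member K z then settle R N Z u K zs
      else if settled R N Z u K z then settle R N Z u (z # K) zs
      else settle R N Z u K zs)"

text \<open>An entry \<open>(u, b)\<close> chooses the next point \<open>u\<close> by its relations to \<open>0\<close> and \<open>b\<close>. Three passes
  over \<open>Z\<close> suffice below.\<close>

fun reconstructs ::
    "(nat \<Rightarrow> nat \<Rightarrow> nat) \<Rightarrow> (nat \<Rightarrow> nat \<Rightarrow> nat list) \<Rightarrow> nat \<Rightarrow> nat list \<Rightarrow> (nat \<times> nat) list \<Rightarrow> bool" where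
  "reconstructs R N n Z [] \<longleftrightarrow> list_all (List.member Z) [0..<n]"
| "reconstructs R N n Z ((u, b) # cs) \<longleftrightarrow>
     u < n \<and> \<not> List.member Z u \<and> List.member Z b \<and>
     list_all (List.member (settle R N Z u [0, b] (Z @ Z @ Z))) Z \<and>
     reconstructs R N n (u # Z) cs"

context alg_iso
begin

text \<open>Soundness of the check: each entry of \<open>cs\<close> extends the faithful map by one
  point, and every index collected by \<open>settle\<close> is \<open>known\<close>. Equality of
  names under \<open>R\<close> has to mean equality of basis relations, whereas \<open>N\<close> may
  list too many points.\<close>

lemma reconstruct_faithful:
  fixes e :: "nat \<Rightarrow> 'a" and R :: "nat \<Rightarrow> nat \<Rightarrow> nat" and N :: "nat \<Rightarrow> nat \<Rightarrow> nat list"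
  assumes inj: "inj_on e {..<n}" and img: "e ` {..<n} = \<Omega>"
    and R: "\<And>i j k l. i < n \<Longrightarrow> j < n \<Longrightarrow> k < n \<Longrightarrow> l < n \<Longrightarrow>
      R i j = R k l \<longleftrightarrow> (\<exists>s\<in>S. (e i, e j) \<in> s \<and> (e k, e l) \<in> s)"
    and N: "\<And>w u v. w < n \<Longrightarrow> u < n \<Longrightarrow> v < n \<Longrightarrow> R w v = R w u \<Longrightarrow> v \<in> set (N w u)"
    and rec: "reconstructs R N n Z cs" "set Z \<subseteq> {..<n}" "0 \<in> set Z" "faithful S \<phi> (e ` set Z) g"
  shows "\<exists>g. faithful S \<phi> \<Omega> g"
  using rec
proof (induction cs arbitrary: Z g)
  case Nil
  then have "{..<n} \<subseteq> set Z" by (auto simp: list_all_iff)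
  then have "e ` set Z = \<Omega>" using Nil.prems(2) img by blast
  then show ?case using Nil.prems by metis
next
  case (Cons c cs)
  obtain u b where c: "c = (u, b)" by (cases c)
  let ?Z = "e ` set Z"
  have u: "u < n" "u \<notin> set Z" and b: "b \<in> set Z"
    and all: "set Z \<subseteq> set (settle R N Z u [0, b] (Z @ Z @ Z))"
    and rec: "reconstructs R N n (u # Z) cs"
    using Cons.prems(1) by (auto simp: c list_all_iff)
  have Z: "\<And>z. z \<in> set Z \<Longrightarrow> z < n" using Cons.prems(2) by blast
  have Z\<Omega>: "?Z \<subseteq> \<Omega>" using Cons.prems(2) img by blast
  have e: "e i \<in> \<Omega>" if "i < n" for i using img that by blast
  have outside: "v \<notin> set Z" if "v < n" "e v \<notin> ?Z" for v using that by blast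
  have eu: "e u \<in> \<Omega>" "e u \<notin> ?Z"
    using e u inj Cons.prems(2) by (auto simp: inj_on_def)
  note g = Cons.prems(4) Z\<Omega>
  obtain u' where u': "u' \<in> \<Omega>'" "u' \<notin> g ` ?Z"
    and r0: "\<And>r. r \<in> S \<Longrightarrow> (e 0, e u) \<in> r \<Longrightarrow> (g (e 0), u') \<in> \<phi> r"
    and rb: "\<And>r. r \<in> S \<Longrightarrow> (e u, e b) \<in> r \<Longrightarrow> (u', g (e b)) \<in> \<phi> r"
    by (rule extension_candidate[OF g eu imageI[OF Cons.prems(3)] imageI[OF b]]) blast
  define known where "known z \<longleftrightarrow> z \<in> set Z \<and> (\<forall>s\<in>S. (e u, e z) \<in> s \<longrightarrow> (u', g (e z)) \<in> \<phi> s)" for z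
  have known_rev: "(g (e w), u') \<in> \<phi> s" if "known w" "s \<in> S" "(e w, e u) \<in> s" for w s
  proof -
    have "(u', g (e w)) \<in> \<phi> (s\<inverse>)" using that X.basis_converse by (auto simp: known_def)
    then show ?thesis using image_converse[OF X.basis_converse[OF that(2)]] by simp
  qed
  \<comment> \<open>Seen from \<open>w\<close>, the index \<open>v\<close> is a stand-in for
    \<open>u'\<close>: it is listed in \<open>N w u\<close> and has the relation to \<open>z\<close>
    that \<open>u'\<close> has to \<open>g (e z)\<close>.\<close>
  have candidate: "\<exists>v. v < n \<and> v \<notin> set Z \<and> v \<in> set (N w u) \<and>
      (\<forall>t\<in>S. (e v, e z) \<in> t \<longleftrightarrow> (u', g (e z)) \<in> \<phi> t)" if w: "known w" and z: "z \<in> set Z" for w z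
  proof -
    have wZ: "w \<in> set Z" using w by (simp add: known_def)
    obtain r where r: "r \<in> S" "(e w, e u) \<in> r" using X.basis_cover e Z[OF wZ] eu(1) by blast
    obtain v where v: "v \<in> \<Omega>" "v \<notin> ?Z" "(e w, v) \<in> r"
      and rel: "\<And>t. t \<in> S \<Longrightarrow> (v, e z) \<in> t \<longleftrightarrow> (u', g (e z)) \<in> \<phi> t"
      by (rule candidate_relation[OF g u' imageI[OF wZ] imageI[OF z] r(1) known_rev[OF w r]]) blast
    obtain i where i: "i < n" "v = e i" using v(1) img by blast
    have "R w i = R w u" using R[OF Z[OF wZ] i(1) Z[OF wZ] u(1)] r v i by blast
    then have "i \<in> set (N w u)" using N Z[OF wZ] u(1) i(1) by blast
    then show ?thesis using i rel outside[OF i(1)] v(2) by blast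
  qed
  have known0: "known 0"
  proof -
    have "(u', g (e 0)) \<in> \<phi> s" if "s \<in> S" "(e u, e 0) \<in> s" for s
      using image_converse[OF X.basis_converse r0[of "s\<inverse>"]] X.basis_converse that by simp
    then show ?thesis using Cons.prems(3) by (simp add: known_def)
  qed
  have step: "known z" if z: "z \<in> set Z" and K: "\<And>w. w \<in> set K \<Longrightarrow> known w"
    and st: "settled R N Z u K z" for z K
  proof -
    obtain v where v: "v < n" "v \<notin> set Z" "v \<in> set (N 0 u)"
      and rel: "\<And>t. t \<in> S \<Longrightarrow> (e v, e z) \<in> t \<longleftrightarrow> (u', g (e z)) \<in> \<phi> t"
      using candidate[OF known0 z] by blast
    \<comment> \<open>The stand-in \<open>v\<close> seen from \<open>0\<close> carries the actual
      relation to \<open>z\<close>. Were it not that of \<open>u\<close>, \<open>settled\<close>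
      would name a \<open>w\<close> from which no stand-in realises it, against
      \<open>candidate\<close>.\<close>
    have "R v z = R u z"
    proof (rule ccontr)
      assume "R v z \<noteq> R u z"
      then obtain w where w: "w \<in> set K" "\<forall>v'\<in>set (N w u). v' \<in> set Z \<or> R v' z \<noteq> R v z"
        using st v by (auto simp: settled_def list_all_iff list_ex_iff)
      obtain v' where v': "v' < n" "v' \<notin> set Z" "v' \<in> set (N w u)"
        and rel': "\<And>t. t \<in> S \<Longrightarrow> (e v', e z) \<in> t \<longleftrightarrow> (u', g (e z)) \<in> \<phi> t"
        using candidate[OF K[OF w(1)] z] by blast
      obtain t where "t \<in> S" "(e v, e z) \<in> t" using X.basis_cover e v(1) Z[OF z] by blast
      then have "R v' z = R v z" using R[OF v'(1) Z[OF z] v(1) Z[OF z]] rel rel' by blast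
      then show False using w v' by blast
    qed
    then obtain s where s: "s \<in> S" "(e v, e z) \<in> s" "(e u, e z) \<in> s"
      using R[OF v(1) Z[OF z] u(1) Z[OF z]] by blast
    have "(u', g (e z)) \<in> \<phi> t" if "t \<in> S" "(e u, e z) \<in> t" for t
      using X.basis_unique[OF s(1) that(1) s(3) that(2)] rel s by blast
    then show ?thesis using z by (simp add: known_def)
  qed
  have settles: "\<forall>z\<in>set (settle R N Z u K zs). known z"
    if "\<forall>z\<in>set K. known z" "set zs \<subseteq> set Z" for K zs
    using that
  proof (induction zs arbitrary: K)
    case (Cons z zs)
    have "\<forall>y\<in>set (settle R N Z u (z # K) zs). known y" if "settled R N Z u K z"
    proof (rule Cons.IH)
      show "\<forall>y\<in>set (z # K). known y" using Cons.prems step[OF _ _ that] by simp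
    qed (use Cons.prems in simp)
    then show ?case using Cons by simp
  qed simp
  have "known b" using rb b by (simp add: known_def)
  then have "\<forall>z\<in>set (settle R N Z u [0, b] (Z @ Z @ Z)). known z"
    using known0 by (intro settles) auto
  then have "\<forall>z\<in>set Z. known z" using all by blast
  then have "faithful S \<phi> (insert (e u) ?Z) (g(e u := u'))"
    using Cons.prems(3) by (intro faithful_insert[OF g imageI[of 0] eu]) (auto simp: known_def)
  then have "faithful S \<phi> (e ` set (u # Z)) (g(e u := u'))" by simp
  moreover have "set (u # Z) \<subseteq> {..<n}" "0 \<in> set (u # Z)" using Cons.prems(2,3) u by auto
  ultimately show ?case using rec by (intro Cons.IH)
qed

end

text \<open>The relation of \<open>i\<close> and \<open>j\<close> in the scheme of \<open>\<int>/n\<close> whose basis sets are the orbits of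
  multiplication by \<open>p\<close>, named by the least element of the orbit of \<open>j - i\<close>. The difference is
  taken as \<open>j + (n - i)\<close>, as \<open>i \<le> n\<close>.\<close>

definition orbit_rep :: "nat \<Rightarrow> nat \<Rightarrow> nat \<Rightarrow> nat \<Rightarrow> nat" where
  "orbit_rep n p d k = Min (set (map (\<lambda>i. (p ^ i * k) mod n) [0..<d]))"

definition cyc_rel :: "nat \<Rightarrow> nat \<Rightarrow> nat \<Rightarrow> nat \<Rightarrow> nat \<Rightarrow> nat" where
  "cyc_rel n p d i j = orbit_rep n p d (j + (n - i))"

definition cyc_nbrs :: "nat \<Rightarrow> nat \<Rightarrow> nat \<Rightarrow> nat \<Rightarrow> nat \<Rightarrow> nat list" where
  "cyc_nbrs n p d w u = map (\<lambda>i. (w + p ^ i * (u + (n - w))) mod n) [0..<d]"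

text \<open>As \<open>p ^ d\<close> is \<open>1\<close> modulo \<open>n\<close>, multiplication by
  \<open>p\<close> is invertible and orbits are disjoint or equal; an equal minimum is a common
  element.\<close>

lemma orbit_rep_eq_iff:
  assumes "p ^ d mod n = 1" "0 < d"
  shows "orbit_rep n p d x = orbit_rep n p d y \<longleftrightarrow> (\<exists>i<d. (p ^ i * x) mod n = y mod n)"
proof -
  define orb where "orb x = (\<lambda>i. (p ^ i * x) mod n) ` {..<d}" for x
  have rep: "orbit_rep n p d x = Min (orb x)" for x
    by (simp add: orbit_rep_def orb_def lessThan_atLeast0)
  have period: "(p ^ (i mod d) * x) mod n = (p ^ i * x) mod n" for i x
  proof -
    have "p ^ i = p ^ (i mod d) * (p ^ d) ^ (i div d)"
      by (metis mod_mult_div_eq power_add power_mult)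
    then have "(p ^ i * x) mod n = (p ^ (i mod d) * x * (p ^ d) ^ (i div d)) mod n"
      by (simp add: ac_simps)
    also have "\<dots> = (p ^ (i mod d) * x * (p ^ d mod n) ^ (i div d)) mod n"
      by (metis mod_mult_right_eq power_mod)
    finally show ?thesis using assms by simp
  qed
  have orbI: "(p ^ i * x) mod n \<in> orb x" for i x
    using period[of i x] assms(2) by (auto simp: orb_def intro!: image_eqI[of _ _ "i mod d"])
  have orb_sub: "orb y \<subseteq> orb x" if yx: "y mod n \<in> orb x" for x y
  proof
    fix z assume "z \<in> orb y"
    then obtain i where "z = (p ^ i * y) mod n" by (auto simp: orb_def)
    moreover obtain j where "y mod n = (p ^ j * x) mod n" using yx unfolding orb_def by blast
    ultimately have "z = (p ^ i * (p ^ j * x)) mod n" by (metis mod_mult_right_eq)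
    then have "z = (p ^ (i + j) * x) mod n" by (simp add: power_add mult.assoc)
    then show "z \<in> orb x" using orbI by simp
  qed
  have orb_sym: "x mod n \<in> orb y" if yx: "y mod n \<in> orb x" for x y
  proof -
    obtain j where j: "j < d" "y mod n = (p ^ j * x) mod n" using yx unfolding orb_def by blast
    have "(p ^ (d - j) * y) mod n = (p ^ (d - j) * (p ^ j * x)) mod n"
      using j(2) by (metis mod_mult_right_eq)
    also have "\<dots> = (p ^ d * x) mod n" using j(1) by (simp add: mult.assoc[symmetric] power_add[symmetric])
    also have "\<dots> = x mod n" using period[of d x] by simp
    finally show ?thesis using orbI[of "d - j" y] by simp
  qed
  have "Min (orb x) = Min (orb y) \<longleftrightarrow> y mod n \<in> orb x"
  proof
    have fin: "finite (orb x)" "orb x \<noteq> {}" for x using assms(2) by (auto simp: orb_def)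
    assume "Min (orb x) = Min (orb y)"
    then obtain z where z: "z \<in> orb x" "z \<in> orb y" using Min_in[OF fin] by metis
    then have "z mod n = z" by (auto simp: orb_def)
    then show "y mod n \<in> orb x" using orb_sub[of z x] orb_sym[of z y] z by auto
  next
    assume "y mod n \<in> orb x"
    then show "Min (orb x) = Min (orb y)" using orb_sub[of y x] orb_sub[of x y] orb_sym[of y x] by simp
  qed
  moreover have "y mod n \<in> orb x \<longleftrightarrow> (\<exists>i<d. (p ^ i * x) mod n = y mod n)"
    unfolding orb_def image_iff by (metis lessThan_iff)
  ultimately show ?thesis by (simp only: rep)
qed

lemma cyc_nbrs_complete:
  assumes "p ^ d mod n = 1" "0 < d" and "w < n" "v < n" and "cyc_rel n p d w v = cyc_rel n p d w u"
  shows "v \<in> set (cyc_nbrs n p d w u)"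
proof -
  obtain i where i: "i < d" "(p ^ i * (u + (n - w))) mod n = (v + (n - w)) mod n"
    using assms(5) orbit_rep_eq_iff[OF assms(1,2)] unfolding cyc_rel_def by metis
  have "(w + p ^ i * (u + (n - w))) mod n = (w + (v + (n - w))) mod n"
    using i(2) by (metis mod_add_right_eq)
  also have "\<dots> = v" using assms by simp
  finally show ?thesis using i(1) by (force simp: cyc_nbrs_def)
qed

section \<open>Primitive elements of finite fields\<close>

text \<open>Multiplication by \<open>x\<close> permutes the nonzero elements, so their product,
  which is nonzero, absorbs this power of \<open>x\<close>.\<close>

lemma power_card_minus_one:
  fixes x :: "'a::field"
  assumes fin: "finite (UNIV :: 'a set)" and "x \<noteq> 0"
  shows "x ^ card (UNIV - {0 :: 'a}) = 1"
proof -
  let ?P = "\<Prod>y\<in>UNIV - {0 :: 'a}. y"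
  have "bij_betw ((*) x) (UNIV - {0}) (UNIV - {0})"
    by (rule bij_betw_byWitness[where f' = "(*) (inverse x)"])
      (use \<open>x \<noteq> 0\<close> in \<open>auto simp: field_simps\<close>)
  then have "?P = (\<Prod>y\<in>UNIV - {0 :: 'a}. x * y)" by (rule prod.reindex_bij_betw[symmetric])
  also have "\<dots> = x ^ card (UNIV - {0 :: 'a}) * ?P" by (simp add: prod.distrib)
  finally show ?thesis using fin by (auto simp: prod_zero_iff)
qed

text \<open>Translation by \<open>1\<close> permutes the field, so summing all elements shows that
  \<open>p ^ d\<close>, and with it \<open>p\<close>, is zero there.\<close>

lemma CHAR_prime_power_field:
  assumes card: "CARD('a::field) = p ^ d" and p: "prime p"
  shows "CHAR('a) = p"
proof -
  have fin: "finite (UNIV :: 'a set)" using card p by (metis card.infinite power_not_zero not_prime_0)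
  have "(\<Sum>x\<in>(UNIV :: 'a set). x + 1) = (\<Sum>x\<in>(UNIV :: 'a set). x)"
    by (rule sum.reindex_bij_betw) (rule bij_betw_byWitness[where f' = "\<lambda>x. x - 1"], auto)
  then have "of_nat (p ^ d) = (0 :: 'a)" by (simp add: sum.distrib card)
  then have "of_nat p = (0 :: 'a)" by simp
  then have "CHAR('a) dvd p" by (simp add: of_nat_eq_0_iff_char_dvd)
  moreover have "CHAR('a) \<noteq> 1" by simp
  ultimately show ?thesis using p by (metis prime_nat_iff)
qed

text \<open>The residue modulo \<open>x ^ d - (c\<^sub>0 + c\<^sub>1 x + \<dots>)\<close> and \<open>p\<close> of a polynomial is represented by the
  list of its \<open>d\<close> coefficients.\<close>

definition mult_root :: "nat \<Rightarrow> nat list \<Rightarrow> nat list \<Rightarrow> nat list" where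
  "mult_root p c v = map2 (\<lambda>a b. (a + last v * b) mod p) (0 # butlast v) c"

definition root_power :: "nat \<Rightarrow> nat list \<Rightarrow> nat \<Rightarrow> nat list" where
  "root_power p c k = (mult_root p c ^^ k) (1 # replicate (length c - 1) 0)"

abbreviation residue_value :: "'a::comm_ring_1 \<Rightarrow> nat list \<Rightarrow> 'a" where
  "residue_value \<equiv> horner_sum of_nat"

definition residue_poly :: "nat list \<Rightarrow> 'a::comm_ring_1 poly" where
  "residue_poly c = monom 1 (length c) - residue_value (monom 1 1) c"

section \<open>Computing with residues modulo a monic polynomial\<close>

lemma of_nat_mod_CHAR: "of_nat (m mod CHAR('a)) = (of_nat m :: 'a::comm_ring_1)"
proof -
  have "(of_nat m :: 'a) = of_nat (m mod CHAR('a) + CHAR('a) * (m div CHAR('a)))" by simp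
  also have "\<dots> = of_nat (m mod CHAR('a))" unfolding of_nat_add of_nat_mult by simp
  finally show ?thesis ..
qed

text \<open>Multiplying by \<open>x\<close> shifts the coefficients. The overflow,
  \<open>last v\<close> times \<open>x ^ length c\<close>, is replaced by \<open>last v\<close>
  times the value of \<open>c\<close>, which explains the last term.\<close>

lemma residue_value_mult_root:
  fixes x :: "'a::comm_ring_1"
  assumes "length v = length c" "c \<noteq> []"
  shows "residue_value x (mult_root CHAR('a) c v) =
    x * residue_value x v - of_nat (last v) * (x ^ length c - residue_value x c)"
proof -
  have "residue_value x (map2 (\<lambda>a b. (a + t * b) mod CHAR('a)) u c) =
      residue_value x u + of_nat t * residue_value x c" if "length u = length c" for u t
    using that by (induction u c rule: list_induct2) (simp_all add: of_nat_mod_CHAR algebra_simps)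
  then have 1: "residue_value x (mult_root CHAR('a) c v) =
      x * residue_value x (butlast v) + of_nat (last v) * residue_value x c"
    using assms by (simp add: mult_root_def)
  have "v = butlast v @ [last v]" using assms by (metis append_butlast_last_id length_0_conv)
  then have "residue_value x v = residue_value x (butlast v) + x ^ (length c - 1) * of_nat (last v)"
    using assms horner_sum_append[of of_nat x "butlast v" "[last v]"] by simp
  moreover have "x ^ length c = x * x ^ (length c - 1)"
    using assms(2) by (cases c) simp_all
  ultimately show ?thesis unfolding 1 by (simp add: algebra_simps)
qed

lemma length_root_power: "c \<noteq> [] \<Longrightarrow> length (root_power p c k) = length c"
  by (induction k) (simp_all add: root_power_def mult_root_def Suc_le_eq)

lemma residue_poly_dvd:
  assumes "c \<noteq> []"
  shows "(residue_poly c :: 'a::comm_ring_1 poly) dvd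
    monom 1 1 ^ k - residue_value (monom 1 1) (root_power CHAR('a) c k)"
proof (induction k)
  case 0
  have "residue_value x (replicate m 0) = 0" for x :: "'a poly" and m by (induction m) simp_all
  then show ?case by (simp add: root_power_def)
next
  case (Suc k)
  let ?v = "root_power CHAR('a) c k" and ?X = "monom 1 1 :: 'a poly"
  \<comment> \<open>The recurrence is used in the polynomial ring, which has the same characteristic
    as \<open>'a\<close>.\<close>
  have "root_power CHAR('a) c (Suc k) = mult_root CHAR('a poly) c ?v"
    by (simp add: root_power_def)
  then have "?X ^ Suc k - residue_value ?X (root_power CHAR('a) c (Suc k)) =
      ?X * (?X ^ k - residue_value ?X ?v) + of_nat (last ?v) * residue_poly c"
    using residue_value_mult_root[of ?v c ?X] length_root_power[OF assms] assms
    by (simp add: residue_poly_def algebra_simps monom_power)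
  then show ?case using Suc by simp
qed

lemma degree_residue_poly:
  assumes "c \<noteq> []"
  shows "degree (residue_poly c :: 'a::field poly) = length c"
proof -
  have "degree (of_nat (c ! i) * monom (1 :: 'a) 1 ^ i) < length c" if "i < length c" for i
    by (rule le_less_trans[OF degree_mult_le]) (use that in \<open>simp add: monom_power degree_monom_eq\<close>)
  then have "degree (residue_value (monom (1 :: 'a) 1) c) < length c"
    unfolding horner_sum_eq_sum using assms by (intro degree_sum_less) auto
  then have "degree (monom (1 :: 'a) (length c) + - residue_value (monom 1 1) c) =
      degree (monom (1 :: 'a) (length c))"
    by (intro degree_add_eq_left) (simp add: degree_monom_eq)
  then show ?thesis by (simp add: residue_poly_def degree_monom_eq)
qed

lemma poly_residue_value:
  "poly (residue_value q v) x = residue_value (poly q x) v"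
  by (induction v) (simp_all add: of_nat_poly)

lemma poly_residue_poly: "poly (residue_poly c) x = x ^ length c - residue_value x c"
  by (simp add: residue_poly_def poly_residue_value poly_monom)

text \<open>\<open>L\<close> is a table of Zech logarithms; its entry at \<open>0\<close> is meaningless. As the powers of a root
  with exponents \<open>0 < k < n\<close> are each one more than some power, none of them is \<open>1\<close> unless the root
  is \<open>0\<close>. The list \<open>P\<close> of the powers is passed as an argument so that rewriting computes it once.\<close>

fun root_powers :: "nat \<Rightarrow> nat list \<Rightarrow> nat list \<Rightarrow> nat \<Rightarrow> nat list list" where
  "root_powers p c v 0 = [v]"
| "root_powers p c v (Suc k) = v # root_powers p c (mult_root p c v) k"

definition is_succ :: "nat \<Rightarrow> nat list list \<Rightarrow> nat \<Rightarrow> nat list \<Rightarrow> bool" where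
  "is_succ p P l v \<longleftrightarrow> l < length P \<and> (hd (P ! l) + 1) mod p # tl (P ! l) = v"

text \<open>The tails skip the exponent \<open>0\<close>; \<open>butlast\<close> drops the exponent
  \<open>n\<close>, whose power has to repeat the first.\<close>

definition zech_check :: "nat \<Rightarrow> nat list list \<Rightarrow> nat list \<Rightarrow> bool" where
  "zech_check p P L \<longleftrightarrow> last P = hd P \<and> list_all2 (is_succ p P) (tl L) (tl (butlast P))"

definition zech_table :: "nat \<Rightarrow> nat list \<Rightarrow> nat \<Rightarrow> nat list \<Rightarrow> bool" where
  "zech_table p c n L \<longleftrightarrow> 0 < n \<and> c \<noteq> [] \<and> length L = n \<and>
     zech_check p (root_powers p c (root_power p c 0) n) L"

lemma length_root_powers [simp]: "length (root_powers p c v k) = Suc k"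
  by (induction k arbitrary: v) simp_all

lemma nth_root_powers: "i \<le> k \<Longrightarrow> root_powers p c v k ! i = (mult_root p c ^^ i) v"
proof (induction k arbitrary: v i)
  case (Suc k)
  then show ?case by (cases i) (simp_all add: funpow_swap1)
qed simp

lemma zech_tableD:
  assumes table: "zech_table p c n L"
  shows "root_power p c n = root_power p c 0"
    and "0 < k \<Longrightarrow> k < n \<Longrightarrow> (hd (root_power p c (L ! k)) + 1) mod p # tl (root_power p c (L ! k)) = root_power p c k"
proof -
  let ?P = "root_powers p c (root_power p c 0) n"
  have P: "?P ! i = root_power p c i" if "i \<le> n" for i
    using that by (simp add: nth_root_powers root_power_def)
  have check: "last ?P = hd ?P" "list_all2 (is_succ p ?P) (tl L) (tl (butlast ?P))"
    and n: "0 < n" "length L = n"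
    using table by (simp_all add: zech_table_def zech_check_def)
  have "?P \<noteq> []" by (metis length_root_powers list.size(3) nat.distinct(1))
  then show "root_power p c n = root_power p c 0"
    using check(1) P[of 0] P[of n] by (simp add: last_conv_nth hd_conv_nth)
  assume k: "0 < k" "k < n"
  have "is_succ p ?P (tl L ! (k - 1)) (tl (butlast ?P) ! (k - 1))"
    using check(2) k n by (auto simp: list_all2_conv_all_nth)
  moreover have "tl L ! (k - 1) = L ! k" "tl (butlast ?P) ! (k - 1) = ?P ! k"
    using k n by (simp_all add: nth_tl nth_butlast)
  ultimately have "is_succ p ?P (L ! k) (root_power p c k)" using k P by simp
  then show "(hd (root_power p c (L ! k)) + 1) mod p # tl (root_power p c (L ! k)) = root_power p c k"
    using P[of "L ! k"] by (simp add: is_succ_def less_Suc_eq_le)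
qed

text \<open>The period makes \<open>residue_poly c\<close> divide \<open>X ^ n - 1\<close>, whose
  roots are all \<open>n\<close> nonzero elements. Without a root of its own it would leave all of
  them to the cofactor \<open>w\<close>, of degree at most \<open>n - length c\<close>.\<close>

lemma residue_poly_root_exists:
  assumes card: "CARD('a::field) = Suc n" and n: "0 < n" and c: "c \<noteq> []"
    and period: "root_power CHAR('a) c n = root_power CHAR('a) c 0"
  shows "\<exists>g :: 'a. poly (residue_poly c) g = 0"
proof (rule ccontr)
  assume no_root: "\<nexists>g :: 'a. poly (residue_poly c) g = 0"
  have fin: "finite (UNIV :: 'a set)" using card by (metis card.infinite nat.distinct(1))
  then have card': "card (UNIV - {0 :: 'a}) = n" using card by simp
  have "residue_value x (replicate m 0) = 0" for x :: "'a poly" and m by (induction m) simp_all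
  then have "residue_value (monom 1 1 :: 'a poly) (root_power CHAR('a) c n) = 1"
    unfolding period by (simp add: root_power_def)
  then have "residue_poly c dvd monom (1 :: 'a) n - 1"
    using residue_poly_dvd[OF c, of n, where 'a = 'a] by (simp add: monom_power)
  then obtain w where w: "monom (1 :: 'a) n - 1 = residue_poly c * w" by (rule dvdE)
  have "coeff (monom (1 :: 'a) n - 1) n = 1" using n by simp
  then have nz: "monom (1 :: 'a) n - 1 \<noteq> 0" by force
  have "degree (monom (1 :: 'a) n - 1) \<le> n"
    by (rule degree_diff_le) (simp_all add: degree_monom_eq)
  then have "length c + degree w \<le> n"
    using nz degree_residue_poly[OF c, where 'a = 'a] unfolding w by (simp add: degree_mult_eq)
  moreover have "UNIV - {0} \<subseteq> {x. poly w x = 0}"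
  proof
    fix x :: 'a assume "x \<in> UNIV - {0}"
    then have "poly (monom 1 n - 1) x = 0"
      using power_card_minus_one[OF fin, of x] card' by (simp add: poly_monom)
    then show "x \<in> {x. poly w x = 0}" using no_root unfolding w by simp
  qed
  then have "n \<le> card {x. poly w x = 0}"
    using card_mono[OF finite_subset[OF _ fin]] card' by (metis subset_UNIV)
  then have "n \<le> degree w" using card_poly_roots_bound[of w] nz w by fastforce
  moreover have "0 < length c" using c by simp
  ultimately show False by linarith
qed

lemma root_power_value:
  fixes g :: "'a::field"
  assumes "poly (residue_poly c) g = 0" "c \<noteq> []"
  shows "residue_value g (root_power CHAR('a) c k) = g ^ k"
proof -
  have "poly (monom 1 1 ^ k - residue_value (monom 1 1) (root_power CHAR('a) c k)) g = 0"
    using residue_poly_dvd[OF assms(2), of k, where 'a = 'a] assms(1)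
    by (metis dvdE mult_zero_left poly_mult)
  then show ?thesis by (simp add: poly_residue_value poly_monom)
qed

text \<open>That \<open>g\<close> generates the multiplicative group is a consequence of the table
  (\<open>power_neq_one\<close>, \<open>power_image\<close>).\<close>

locale primitive_element =
  fixes g :: "'a::field" and p :: nat and c :: "nat list" and n :: nat and L :: "nat list"
  assumes prime: "prime p" and card: "CARD('a) = p ^ length c" and n: "n = p ^ length c - 1"
    and root: "poly (residue_poly c) g = 0" and table: "zech_table p c n L"

lemma primitive_element_exists:
  assumes "prime p" "CARD('a::field) = p ^ length c" "n = p ^ length c - 1" "zech_table p c n L"
  shows "\<exists>g :: 'a. primitive_element g p c n L"
proof -
  have "CARD('a) = Suc n" using assms by (simp add: prime_gt_0_nat)
  then obtain g :: 'a where "poly (residue_poly c) g = 0"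
    using residue_poly_root_exists[of n c] assms(4) CHAR_prime_power_field[OF assms(2,1)]
    zech_tableD(1)[OF assms(4)] by (auto simp: zech_table_def)
  then show ?thesis using assms by (auto simp: primitive_element_def)
qed

section \<open>Discrete logarithms to the base \<open>g\<close>\<close>

context primitive_element
begin

lemma CHAR: "CHAR('a) = p"
  by (rule CHAR_prime_power_field[OF card prime])

lemma fin: "finite (UNIV :: 'a set)"
  using card prime by (metis card.infinite power_not_zero not_prime_0)

lemma pos: "0 < n" "c \<noteq> []"
  using table by (simp_all add: zech_table_def)

lemma card_units: "card (UNIV - {0 :: 'a}) = n"
  using fin by (simp add: card n)

lemma period: "g ^ n = 1"
  using root_power_value[OF root pos(2), of n] root_power_value[OF root pos(2), of 0]
    zech_tableD(1)[OF table] by (simp add: CHAR)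

lemma nonzero: "g \<noteq> 0"
  using period pos by (auto simp: power_0_left)

lemma zech: "0 < k \<Longrightarrow> k < n \<Longrightarrow> g ^ (L ! k) + 1 = g ^ k"
proof -
  assume k: "0 < k" "k < n"
  let ?v = "root_power p c (L ! k)"
  obtain a v where v: "?v = a # v"
    using length_root_power[OF pos(2), of p "L ! k"] pos(2) by (cases ?v) auto
  have "root_power p c k = (hd ?v + 1) mod p # tl ?v"
    using zech_tableD(2)[OF table k] by simp
  then have "root_power p c k = (a + 1) mod p # v" using v by simp
  then have "g ^ k = residue_value g ((a + 1) mod p # v)"
    using root_power_value[OF root pos(2), of k] by (simp add: CHAR)
  also have "\<dots> = residue_value g ?v + 1"
    using of_nat_mod_CHAR[of "a + 1", where 'a = 'a] v by (simp add: CHAR)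
  also have "\<dots> = g ^ (L ! k) + 1"
    using root_power_value[OF root pos(2), of "L ! k"] by (simp add: CHAR)
  finally show ?thesis ..
qed

lemma power_neq_one: "0 < k \<Longrightarrow> k < n \<Longrightarrow> g ^ k \<noteq> 1"
  using zech[of k] nonzero by fastforce

lemma power_mod: "g ^ (k mod n) = g ^ k"
proof -
  have "g ^ k = g ^ (k mod n + n * (k div n))" by simp
  also have "\<dots> = g ^ (k mod n)" unfolding power_add power_mult period by simp
  finally show ?thesis ..
qed

lemma power_inj: "inj_on ((^) g) {..<n}"
proof -
  have "i = j" if "i \<le> j" "j < n" "g ^ i = g ^ j" for i j
  proof -
    have "g ^ i * g ^ (j - i) = g ^ i * 1"
      using that by (metis le_add_diff_inverse mult.right_neutral power_add)
    then have "g ^ (j - i) = 1" using nonzero by simp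
    then show ?thesis using power_neq_one[of "j - i"] that by (cases "i = j") auto
  qed
  then show ?thesis by (intro inj_onI) (metis lessThan_iff nat_le_linear)
qed

lemma power_image: "(^) g ` {..<n} = UNIV - {0}"
proof (rule card_subset_eq)
  show "finite (UNIV - {0 :: 'a})" using fin by simp
  show "(^) g ` {..<n} \<subseteq> UNIV - {0}" using nonzero by auto
  show "card ((^) g ` {..<n}) = card (UNIV - {0 :: 'a})"
    using card_image[OF power_inj] card_units by simp
qed

lemma power_eq_iff: "g ^ i = g ^ j \<longleftrightarrow> i mod n = j mod n"
  using power_inj pos by (metis inj_on_def lessThan_iff mod_less_divisor power_mod)

lemma power_exists: "x \<noteq> 0 \<Longrightarrow> \<exists>k<n. x = g ^ k"
  using power_image by (auto simp: image_iff set_eq_iff)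

end

section \<open>The scheme \<open>C(p\<^sup>d)\<close>\<close>

context primitive_element
begin

text \<open>Raising further to the power \<open>p ^ (length c - e)\<close> gives the identity, so
  the map is injective; additivity is the binomial theorem in characteristic
  \<open>p\<close>.\<close>

lemma frobenius_automorphism:
  assumes e: "e \<le> length c"
  shows "(\<lambda>x. x ^ p ^ e) \<in> (field_automorphisms :: ('a \<Rightarrow> 'a) set)"
proof -
  have period: "x ^ p ^ length c = x" for x :: 'a
  proof (cases "x = 0")
    case False
    have "p ^ length c = Suc n" using prime by (simp add: n prime_gt_0_nat)
    then show ?thesis using power_card_minus_one[OF fin False] by (simp add: card_units)
  qed (use prime in \<open>simp add: prime_gt_0_nat power_0_left\<close>)
  have "inj (\<lambda>x :: 'a. x ^ p ^ e)"
  proof (rule injI)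
    fix x y :: 'a assume "x ^ p ^ e = y ^ p ^ e"
    then have "(x ^ p ^ e) ^ p ^ (length c - e) = (y ^ p ^ e) ^ p ^ (length c - e)" by simp
    then show "x = y" using e period by (simp add: power_mult[symmetric] power_add[symmetric])
  qed
  then have "bij (\<lambda>x :: 'a. x ^ p ^ e)" using finite_UNIV_inj_surj[OF fin] by (simp add: bij_def)
  then show ?thesis
    using freshmans_dream'[where 'a = 'a, of "p ^ e" e] prime
    by (auto simp: field_automorphisms_def CHAR power_mult_distrib)
qed

text \<open>An automorphism fixes the prime field, so it sends \<open>g\<close> to a root of
  \<open>residue_poly c\<close>. There are at most \<open>length c\<close> roots, and the powers
  \<open>g ^ p ^ e\<close> already provide that many; the image of the generator \<open>g\<close>
  decides the rest.\<close>

lemma automorphism_frobenius: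
  assumes \<sigma>: "\<sigma> \<in> field_automorphisms"
  shows "\<exists>e<length c. \<forall>x :: 'a. \<sigma> x = x ^ p ^ e"
proof -
  have hom: "\<tau> (residue_value x v) = residue_value (\<tau> x) v" "\<tau> (x ^ k) = \<tau> x ^ k"
    if \<tau>: "\<tau> \<in> field_automorphisms" for \<tau> :: "'a \<Rightarrow> 'a" and x v k
  proof -
    have add: "\<And>x y. \<tau> (x + y) = \<tau> x + \<tau> y" and mult: "\<And>x y. \<tau> (x * y) = \<tau> x * \<tau> y"
      using \<tau> by (auto simp: field_automorphisms_def)
    note fix\<tau> = field_automorphism_fix[OF \<tau>]
    have "\<tau> (of_nat k) = of_nat k" for k by (induction k) (simp_all add: add fix\<tau>)
    then show "\<tau> (residue_value x v) = residue_value (\<tau> x) v"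
      by (induction v) (simp_all add: add mult fix\<tau>)
    show "\<tau> (x ^ k) = \<tau> x ^ k" by (induction k) (simp_all add: mult fix\<tau>)
  qed
  let ?R = "{x :: 'a. poly (residue_poly c) x = 0}"
  have image_root: "\<tau> g \<in> ?R" if "\<tau> \<in> field_automorphisms" for \<tau>
    using hom[OF that] root by (simp add: poly_residue_poly) metis
  have deg: "degree (residue_poly c :: 'a poly) = length c" by (rule degree_residue_poly[OF pos(2)])
  then have "(residue_poly c :: 'a poly) \<noteq> 0" using pos by auto
  then have R: "finite ?R" "card ?R \<le> length c"
    using poly_roots_finite card_poly_roots_bound deg by metis+
  let ?F = "(\<lambda>e. g ^ p ^ e) ` {..<length c}"
  have sub: "?F \<subseteq> ?R" using image_root[OF frobenius_automorphism] by auto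
  have "inj_on (\<lambda>e. g ^ p ^ e) {..<length c}"
  proof (rule inj_onI)
    fix e f assume ef: "e \<in> {..<length c}" "f \<in> {..<length c}" "g ^ p ^ e = g ^ p ^ f"
    \<comment> \<open>Cancelling one factor \<open>g\<close> leaves the exponents
      \<open>p ^ e - 1\<close>, which lie below \<open>n\<close>, where powers of \<open>g\<close>
      are distinct.\<close>
    have lt: "p ^ e - 1 < n" and Suc: "p ^ e = Suc (p ^ e - 1)" if "e < length c" for e
      using power_strict_increasing[OF that prime_gt_1_nat[OF prime]] prime_gt_0_nat[OF prime]
      by (simp_all add: n diff_less_mono Suc_le_eq)
    have "g ^ (p ^ e - 1) = g ^ (p ^ f - 1)"
      using ef Suc[of e] Suc[of f] nonzero by (metis lessThan_iff mult_left_cancel power_Suc)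
    then have "p ^ e = p ^ f"
      using power_inj lt[of e] lt[of f] Suc[of e] Suc[of f] ef by (metis inj_on_def lessThan_iff)
    then show "e = f" using prime_gt_1_nat[OF prime] by (simp add: power_inject_exp)
  qed
  then have "card ?F = length c" by (simp add: card_image)
  then have "?F = ?R" using card_subset_eq[OF R(1) sub] card_mono[OF R(1) sub] R(2) by simp
  then obtain e where e: "e < length c" "\<sigma> g = g ^ p ^ e" using image_root[OF \<sigma>] by blast
  have "\<sigma> x = x ^ p ^ e" for x
  proof (cases "x = 0")
    case True
    then show ?thesis
      using field_automorphism_fix[OF \<sigma>] prime by (simp add: prime_gt_0_nat power_0_left)
  next
    case False
    then obtain k where "x = g ^ k" using power_exists by blast
    then show ?thesis using hom(2)[OF \<sigma>, of g k] e by (simp add: power_mult[symmetric] mult.commute)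
  qed
  then show ?thesis using e by blast
qed

lemma p_power_mod: "p ^ length c mod n = 1 mod n"
proof -
  have "p ^ length c = 1 + n" using prime by (simp add: n prime_gt_0_nat)
  then show ?thesis by (simp only: mod_add_self2)
qed

lemma power_shift: "i < n \<Longrightarrow> g ^ (j + (n - i)) = g ^ j / g ^ i"
  using nonzero period by (simp add: power_add power_diff)

text \<open>In \<open>(a * \<sigma> x, a * \<sigma> y)\<close> the scalar cancels from the quotient,
  so a basis relation amounts to a quotient up to powers \<open>p ^ e\<close>. For discrete
  logarithms this is a difference up to multiplication by \<open>p ^ e\<close>.\<close>

lemma C_relation:
  assumes n1: "1 < n" and ij: "i < n" "j < n" "k < n" "l < n"
  shows "cyc_rel n p (length c) i j = cyc_rel n p (length c) k l \<longleftrightarrow>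
    (\<exists>s\<in>C_basis. (g ^ i, g ^ j) \<in> s \<and> (g ^ k, g ^ l) \<in> s)"
proof -
  note rep = orbit_rep_eq_iff[of p "length c" n]
  have p1: "p ^ length c mod n = 1" using p_power_mod n1 by simp
  have len: "0 < length c" using pos by simp
  have rel: "cyc_rel n p (length c) i j = cyc_rel n p (length c) k l \<longleftrightarrow>
      (\<exists>e<length c. (g ^ j / g ^ i) ^ p ^ e = g ^ l / g ^ k)" if "i < n" "k < n" for i j k l
  proof -
    have "(p ^ e * (j + (n - i))) mod n = (l + (n - k)) mod n \<longleftrightarrow>
        (g ^ j / g ^ i) ^ p ^ e = g ^ l / g ^ k" for e
    proof -
      have "g ^ (p ^ e * (j + (n - i))) = (g ^ (j + (n - i))) ^ p ^ e"
        by (metis mult.commute power_mult)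
      then show ?thesis unfolding power_eq_iff[symmetric] using that by (simp only: power_shift)
    qed
    then show ?thesis unfolding cyc_rel_def rep[OF p1 len] by simp
  qed
  show ?thesis
  proof
    assume "cyc_rel n p (length c) i j = cyc_rel n p (length c) k l"
    then obtain e where e: "e < length c" "(g ^ j / g ^ i) ^ p ^ e = g ^ l / g ^ k"
      using rel ij by blast
    let ?s = "{(a * \<sigma> (g ^ i), a * \<sigma> (g ^ j)) | a \<sigma>. a \<noteq> 0 \<and> \<sigma> \<in> field_automorphisms}"
    have mem: "(a * \<sigma> (g ^ i), a * \<sigma> (g ^ j)) \<in> ?s" if "a \<noteq> 0" "\<sigma> \<in> field_automorphisms" for a \<sigma>
      using that by blast
    have "?s \<in> C_basis" unfolding C_basis_def using nonzero by fastforce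
    moreover have "(g ^ i, g ^ j) \<in> ?s"
      using mem[of 1, OF _ frobenius_automorphism[of 0]] by simp
    moreover have "(g ^ k, g ^ l) \<in> ?s"
    proof -
      define a where "a = g ^ k / (g ^ i) ^ p ^ e"
      have "a * (g ^ j) ^ p ^ e = g ^ k * (g ^ j / g ^ i) ^ p ^ e"
        by (simp add: a_def power_divide)
      also have "\<dots> = g ^ l" unfolding e(2) using nonzero by simp
      finally have l: "a * (g ^ j) ^ p ^ e = g ^ l" .
      have a: "a \<noteq> 0" and k: "a * (g ^ i) ^ p ^ e = g ^ k" using nonzero by (simp_all add: a_def)
      show ?thesis
        using mem[OF a frobenius_automorphism[OF less_imp_le[OF e(1)]]] unfolding k l .
    qed
    ultimately show "\<exists>s\<in>C_basis. (g ^ i, g ^ j) \<in> s \<and> (g ^ k, g ^ l) \<in> s"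
      by (intro bexI[of _ ?s] conjI)
  next
    assume "\<exists>s\<in>C_basis. (g ^ i, g ^ j) \<in> s \<and> (g ^ k, g ^ l) \<in> s"
    then obtain x y where xy: "x \<noteq> 0" "y \<noteq> 0"
      and s: "\<exists>a \<sigma>. g ^ i = a * \<sigma> x \<and> g ^ j = a * \<sigma> y \<and> a \<noteq> 0 \<and> \<sigma> \<in> field_automorphisms"
        "\<exists>a \<sigma>. g ^ k = a * \<sigma> x \<and> g ^ l = a * \<sigma> y \<and> a \<noteq> 0 \<and> \<sigma> \<in> field_automorphisms"
      unfolding C_basis_def by blast
    obtain u v where uv: "u < n" "v < n" "x = g ^ u" "y = g ^ v" using power_exists xy by metis
    have "cyc_rel n p (length c) u v = cyc_rel n p (length c) i j"
      if "i < n" and s: "\<exists>a \<sigma>. g ^ i = a * \<sigma> x \<and> g ^ j = a * \<sigma> y \<and> a \<noteq> 0 \<and> \<sigma> \<in> field_automorphisms"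
      for i j
    proof -
      obtain a \<sigma> where a: "g ^ i = a * \<sigma> x" "g ^ j = a * \<sigma> y" "a \<noteq> 0" "\<sigma> \<in> field_automorphisms"
        using s by blast
      obtain e where e: "e < length c" "\<And>x. \<sigma> x = x ^ p ^ e"
        using automorphism_frobenius[OF a(4)] by blast
      have "(g ^ v / g ^ u) ^ p ^ e = g ^ j / g ^ i"
        using a e uv by (simp add: power_divide)
      then show ?thesis unfolding rel[OF uv(1) \<open>i < n\<close>] using e by blast
    qed
    from this[OF ij(1) s(1)] this[OF ij(3) s(2)]
    show "cyc_rel n p (length c) i j = cyc_rel n p (length c) k l" by simp
  qed
qed

lemma separable_C_basis:
  assumes n1: "1 < n" and rec: "reconstructs (cyc_rel n p (length c)) (cyc_nbrs n p (length c)) n [0] cs"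
  shows "separable TYPE('b) (UNIV - {0 :: 'a}) C_basis"
  unfolding separable_def
proof (intro allI impI, elim conjE)
  fix \<Omega>' :: "'b set" and S' \<phi>
  assume "coherent_configuration \<Omega>' S'" "algebraic_isomorphism (C_basis :: ('a \<times> 'a) set set) S' \<phi>"
  then interpret alg_iso "UNIV - {0 :: 'a}" C_basis \<Omega>' S' \<phi>
    using scheme_C_basis[OF fin] by unfold_locales (simp_all add: scheme_def)
  have p1: "p ^ length c mod n = 1" using p_power_mod n1 by simp
  have len: "0 < length c" using pos by simp
  obtain g0 where "faithful C_basis \<phi> {g ^ 0} g0"
    using faithful_singleton[of "g ^ 0"] by auto
  then have "\<exists>f. faithful C_basis \<phi> (UNIV - {0}) f"
    using n1 by (intro reconstruct_faithful[OF power_inj power_image C_relation[OF n1]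
        cyc_nbrs_complete[OF p1 len] rec]) simp_all
  moreover have "(1 :: 'a) \<in> UNIV - {0}" by simp
  ultimately show "\<exists>f. isomorphism (UNIV - {0}) C_basis \<Omega>' S' f \<and> induced_by C_basis \<phi> f"
    using faithful_induces by blast
qed

end

section \<open>The 2-extension\<close>

context coherent
begin

lemma union_iff:
  "is_union_of R S \<longleftrightarrow> R \<subseteq> \<Omega> \<times> \<Omega> \<and> (\<forall>t\<in>S. \<forall>p\<in>t. \<forall>q\<in>t. p \<in> R \<longrightarrow> q \<in> R)"
proof
  assume R: "is_union_of R S"
  then have "R \<subseteq> \<Omega> \<times> \<Omega>" using basis_subset unfolding is_union_of_def by blast
  then show "R \<subseteq> \<Omega> \<times> \<Omega> \<and> (\<forall>t\<in>S. \<forall>p\<in>t. \<forall>q\<in>t. p \<in> R \<longrightarrow> q \<in> R)"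
    using Union_sub_partition[OF part R] by blast
next
  assume R: "R \<subseteq> \<Omega> \<times> \<Omega> \<and> (\<forall>t\<in>S. \<forall>p\<in>t. \<forall>q\<in>t. p \<in> R \<longrightarrow> q \<in> R)"
  have eq: "R = \<Union> {t \<in> S. t \<subseteq> R}"
  proof (intro equalityI subsetI)
    fix p assume p: "p \<in> R"
    then have "fst p \<in> \<Omega>" "snd p \<in> \<Omega>" using R by auto
    then obtain t where t: "t \<in> S" "p \<in> t" using basis_cover[of "fst p" "snd p"] by auto
    then have "t \<subseteq> R" using R p by blast
    then show "p \<in> \<Union> {t \<in> S. t \<subseteq> R}" using t by blast
  qed auto
  show "is_union_of R S"
    unfolding is_union_of_def by (rule exI[of _ "{t \<in> S. t \<subseteq> R}"], rule conjI[OF _ eq]) blast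
qed

lemma union_subset: "is_union_of R S \<Longrightarrow> R \<subseteq> \<Omega> \<times> \<Omega>"
  by (simp add: union_iff)

lemma union_closed: "is_union_of R S \<Longrightarrow> t \<in> S \<Longrightarrow> p \<in> t \<Longrightarrow> p \<in> R \<Longrightarrow> t \<subseteq> R"
  unfolding union_iff by blast

lemma union_basis: "s \<in> S \<Longrightarrow> is_union_of s S"
  unfolding is_union_of_def by (intro exI[of _ "{s}"]) simp

lemma union_full: "is_union_of (\<Omega> \<times> \<Omega>) S"
  using basis_subset unfolding union_iff by blast

lemma union_Id: "is_union_of (Id_on \<Omega>) S"
  using cc by (simp add: coherent_configuration_def)

lemma union_Int:
  assumes R: "is_union_of R S" and Q: "is_union_of Q S"
  shows "is_union_of (R \<inter> Q) S"
  unfolding union_iff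
proof (intro conjI ballI impI)
  show "R \<inter> Q \<subseteq> \<Omega> \<times> \<Omega>" using union_subset[OF R] by auto
  show "q \<in> R \<inter> Q" if "t \<in> S" "p \<in> t" "q \<in> t" "p \<in> R \<inter> Q" for t p q
    using union_closed[OF R that(1,2)] union_closed[OF Q that(1,2)] that by auto
qed

text \<open>The number of intermediate points is constant on a basis relation, hence so is its being
  positive.\<close>

lemma union_relcomp:
  assumes R: "is_union_of R S" and Q: "is_union_of Q S"
  shows "is_union_of (R O Q) S"
  unfolding union_iff
proof (intro conjI ballI impI)
  show "R O Q \<subseteq> \<Omega> \<times> \<Omega>" using union_subset[OF R] union_subset[OF Q] by blast
  fix t p q assume t: "t \<in> S" "p \<in> t" "q \<in> t" and p: "p \<in> R O Q"
  let ?N = "\<lambda>p. {z. (fst p, z) \<in> R \<and> (z, snd p) \<in> Q}"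
  have fin: "finite (?N p)" for p
    by (rule finite_subset[OF _ finite_points]) (use union_subset[OF R] in auto)
  have "card (?N p) = card (?N q)"
    by (rule coherent_union_count[OF cc R Q t(1)]) (use t in simp_all)
  moreover have "?N p \<noteq> {}" using p by auto
  ultimately have "?N q \<noteq> {}" using fin by (metis card_eq_0_iff)
  then obtain z where "(fst q, z) \<in> R" "(z, snd q) \<in> Q" by blast
  then show "q \<in> R O Q" by (metis prod.collapse relcomp.relcompI)
qed

section \<open>Unions of basis relations in the 2-extension\<close>

lemma fission: "diagonal_fission \<Omega> S (two_extension \<Omega> S)"
  using is_two_extension_two_extension[OF cc] by (simp add: is_two_extension_def)

interpretation two: coherent "\<Omega> \<times> \<Omega>" "two_extension \<Omega> S"
  using fission by unfold_locales (simp add: diagonal_fission_def)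

lemma two_diagonal: "is_union_of (Id_on (Id_on \<Omega>)) (two_extension \<Omega> S)"
  using fission by (simp add: diagonal_fission_def)

lemma two_tensor:
  assumes R: "is_union_of R S" and Q: "is_union_of Q S"
  shows "is_union_of (tensor_rel R Q) (two_extension \<Omega> S)"
  unfolding two.union_iff
proof (intro conjI ballI impI)
  show "tensor_rel R Q \<subseteq> (\<Omega> \<times> \<Omega>) \<times> \<Omega> \<times> \<Omega>"
    using union_subset[OF R] union_subset[OF Q] by (auto simp: tensor_rel_def)
  fix t p q assume t: "t \<in> two_extension \<Omega> S" "p \<in> t" "q \<in> t" and p: "p \<in> tensor_rel R Q"
  have "\<exists>y\<in>tensor_square S. t \<subseteq> y"
    using fission t by (auto simp: diagonal_fission_def refines_def)
  then obtain r s where rs: "r \<in> S" "s \<in> S" "t \<subseteq> tensor_rel r s"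
    by (auto simp: tensor_square_def)
  obtain x y z w where xy: "p = ((x, y), (z, w))" by (metis surj_pair)
  have "(x, z) \<in> r" "(y, w) \<in> s" using t(2) rs(3) by (auto simp: xy tensor_rel_def)
  moreover have "(x, z) \<in> R" "(y, w) \<in> Q" using p by (auto simp: xy tensor_rel_def)
  ultimately have "r \<subseteq> R" "s \<subseteq> Q"
    using union_closed[OF R rs(1)] union_closed[OF Q rs(2)] by blast+
  then have "tensor_rel r s \<subseteq> tensor_rel R Q" by (auto simp: tensor_rel_def)
  then show "q \<in> tensor_rel R Q" using rs(3) t(3) by blast
qed

lemma two_first: "is_union_of (tensor_rel (Id_on \<Omega>) (\<Omega> \<times> \<Omega>)) (two_extension \<Omega> S)"
  by (rule two_tensor[OF union_Id union_full])

lemma two_proj1: "is_union_of {((u, v), (u, u)) | u v. u \<in> \<Omega> \<and> v \<in> \<Omega>} (two_extension \<Omega> S)"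
proof -
  have "{((u, v), (u, u)) | u v. u \<in> \<Omega> \<and> v \<in> \<Omega>} =
      tensor_rel (Id_on \<Omega>) (\<Omega> \<times> \<Omega>) O Id_on (Id_on \<Omega>)"
    by (auto simp: tensor_rel_def relcomp_unfold)
  then show ?thesis using two.union_relcomp[OF two_first two_diagonal] by simp
qed

lemma two_proj2: "is_union_of {((u, v), (v, v)) | u v. u \<in> \<Omega> \<and> v \<in> \<Omega>} (two_extension \<Omega> S)"
proof -
  have "{((u, v), (v, v)) | u v. u \<in> \<Omega> \<and> v \<in> \<Omega>} =
      tensor_rel (\<Omega> \<times> \<Omega>) (Id_on \<Omega>) O Id_on (Id_on \<Omega>)"
    by (auto simp: tensor_rel_def relcomp_unfold)
  then show ?thesis
    using two.union_relcomp[OF two_tensor[OF union_full union_Id] two_diagonal] by simp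
qed

lemma two_Delta:
  assumes "is_union_of R S"
  shows "is_union_of (Delta R) (two_extension \<Omega> S)"
proof -
  have "Delta R = Id_on (Id_on \<Omega>) O tensor_rel R R O Id_on (Id_on \<Omega>)"
  proof (intro equalityI subsetI)
    fix q assume "q \<in> Delta R"
    then obtain x y where q: "q = ((x, x), (y, y))" "(x, y) \<in> R" by (auto simp: Delta_def)
    then have "((x, x), (x, x)) \<in> Id_on (Id_on \<Omega>)" "((x, x), (y, y)) \<in> tensor_rel R R"
      "((y, y), (y, y)) \<in> Id_on (Id_on \<Omega>)"
      using union_subset[OF assms] by (auto simp: tensor_rel_def)
    then show "q \<in> Id_on (Id_on \<Omega>) O tensor_rel R R O Id_on (Id_on \<Omega>)" unfolding q by blast
  qed (auto simp: tensor_rel_def Delta_def)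
  then show ?thesis
    using two.union_relcomp[OF two_diagonal two.union_relcomp[OF two_tensor[OF assms assms] two_diagonal]]
    by simp
qed

text \<open>The basis relation of \<open>((a, b), (c, x))\<close> is at least as fine as the colour of \<open>x\<close> after one
  round of colour refinement that starts from the relations to \<open>a\<close>, \<open>b\<close> and \<open>c\<close>.\<close>

lemma two_count:
  assumes R: "is_union_of R\<^sub>1 S" "is_union_of R\<^sub>2 S" "is_union_of R\<^sub>3 S" and Q: "is_union_of Q S"
    and t: "t \<in> two_extension \<Omega> S" "((a, b), (c, x)) \<in> t" "((a, b), (c, y)) \<in> t"
  shows "card {z. (a, z) \<in> R\<^sub>1 \<and> (b, z) \<in> R\<^sub>2 \<and> (c, z) \<in> R\<^sub>3 \<and> (z, x) \<in> Q} =
    card {z. (a, z) \<in> R\<^sub>1 \<and> (b, z) \<in> R\<^sub>2 \<and> (c, z) \<in> R\<^sub>3 \<and> (z, y) \<in> Q}"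
proof -
  \<comment> \<open>For a target \<open>(c, z)\<close>: \<open>?N1\<close> goes via
    \<open>(a, a)\<close> and tests \<open>(a, z)\<close>, \<open>?N2\<close> tests
    \<open>(b, z)\<close>, and \<open>?N3\<close> goes via a diagonal point that must be
    \<open>(c, c)\<close> and tests \<open>(c, z)\<close>. The relation \<open>?T\<close> forces the
    first coordinate \<open>c\<close> on the target.\<close>
  let ?p1 = "{((u, v), (u, u)) | u v. u \<in> \<Omega> \<and> v \<in> \<Omega>}"
  let ?N1 = "?p1 O tensor_rel (\<Omega> \<times> \<Omega>) R\<^sub>1"
  let ?N2 = "tensor_rel (\<Omega> \<times> \<Omega>) R\<^sub>2"
  let ?N3 = "tensor_rel (\<Omega> \<times> \<Omega>) (\<Omega> \<times> \<Omega>) O Id_on (Id_on \<Omega>) O tensor_rel (Id_on \<Omega>) R\<^sub>3"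
  let ?N = "?N1 \<inter> ?N2 \<inter> ?N3" and ?T = "tensor_rel (Id_on \<Omega>) Q"
  have N: "is_union_of ?N (two_extension \<Omega> S)"
    by (intro two.union_Int two.union_relcomp two_tensor two_proj1 two_diagonal union_full union_Id R)
  have T: "is_union_of ?T (two_extension \<Omega> S)" by (intro two_tensor union_Id Q)
  have pts: "a \<in> \<Omega>" "b \<in> \<Omega>" "c \<in> \<Omega>" using two.basis_points[OF t(1,2)] by auto
  have paths: "{q. ((a, b), q) \<in> ?N \<and> (q, (c, x)) \<in> ?T} =
      Pair c ` {z. (a, z) \<in> R\<^sub>1 \<and> (b, z) \<in> R\<^sub>2 \<and> (c, z) \<in> R\<^sub>3 \<and> (z, x) \<in> Q}" for x
    using pts union_subset[OF R(1)] by (fastforce simp: tensor_rel_def relcomp_unfold)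
  have "card {q. ((a, b), q) \<in> ?N \<and> (q, (c, x)) \<in> ?T} = card {q. ((a, b), q) \<in> ?N \<and> (q, (c, y)) \<in> ?T}"
    by (rule coherent_union_count[OF two.cc N T t])
  then show ?thesis unfolding paths by (simp add: card_image inj_on_def)
qed

text \<open>The algebraic isomorphism \<open>\<psi>\<close> between the 2-extensions is not assumed to respect the tensor
  squares. Therefore not points of \<open>\<Omega>\<close> but pairs are mapped one after the other: the pair
  \<open>(a, b)\<close>, the pairs \<open>(c, x)\<close>, each of which is determined by its relations to \<open>(a, b)\<close> and
  \<open>(c, c)\<close>, and finally the pairs \<open>(x, x)\<close>, which are determined by \<open>(c, x)\<close>.\<close>

lemma two_separable_three_points:
  assumes abc: "a \<in> \<Omega>" "b \<in> \<Omega>" "c \<in> \<Omega>" "a \<noteq> c"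
    and determined: "\<And>t x y. t \<in> two_extension \<Omega> S \<Longrightarrow> ((a, b), (c, x)) \<in> t \<Longrightarrow> ((a, b), (c, y)) \<in> t \<Longrightarrow> x = y"
  shows "two_separable TYPE('b) \<Omega> S"
  unfolding two_separable_def
proof (intro allI impI, elim conjE)
  let ?Y = "two_extension \<Omega> S"
  fix \<Omega>' :: "'b set" and S' \<phi>
  assume cc': "coherent_configuration \<Omega>' S'" and "two_isomorphism \<Omega> S \<Omega>' S' \<phi>"
  then obtain \<psi> where \<phi>: "algebraic_isomorphism S S' \<phi>"
    and \<psi>: "algebraic_isomorphism ?Y (two_extension \<Omega>' S') \<psi>"
    and \<Delta>: "\<And>s. s \<in> S \<Longrightarrow> on_unions ?Y \<psi> (Delta s) = Delta (\<phi> s)"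
    by (auto simp: two_isomorphism_def)
  interpret X': coherent \<Omega>' S' by unfold_locales (rule cc')
  interpret one: alg_iso \<Omega> S \<Omega>' S' \<phi> by unfold_locales (rule \<phi>)
  interpret alg_iso "\<Omega> \<times> \<Omega>" ?Y "\<Omega>' \<times> \<Omega>'" "two_extension \<Omega>' S'" \<psi>
    using X'.fission \<psi> by unfold_locales (simp_all add: diagonal_fission_def)
  \<comment> \<open>Equality of first coordinates is a union of basis relations, so it cannot hold
    for only one of two elements of \<open>t\<close>.\<close>
  have first: "fst q = fst p" if "t \<in> ?Y" "(p, q) \<in> t" "(p', q') \<in> t" "fst q' = fst p'" for t p q p' q'
  proof -
    have "(p', q') \<in> tensor_rel (Id_on \<Omega>) (\<Omega> \<times> \<Omega>)"
      using two.basis_points[OF that(1,3)] that(4) by (cases p'; cases q') (auto simp: tensor_rel_def)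
    then have "(p, q) \<in> tensor_rel (Id_on \<Omega>) (\<Omega> \<times> \<Omega>)"
      using two.union_closed[OF two_first that(1,3)] that(2) by blast
    then show ?thesis by (auto simp: tensor_rel_def)
  qed
  have converse_rel: "(v, u) \<in> \<psi> r"
    if "r \<in> ?Y" "(y, x) \<in> r" "\<And>s. s \<in> ?Y \<Longrightarrow> (x, y) \<in> s \<Longrightarrow> (u, v) \<in> \<psi> s" for r x y u v
    using image_converse[OF two.basis_converse[OF that(1)] that(3)[OF two.basis_converse[OF that(1)]]]
      that(2) by simp
  define A where "A = (a, b)"
  define P where "P x = (c, x)" for x :: 'a
  define Q where "Q x = (x, x)" for x :: 'a
  have pts: "A \<in> \<Omega> \<times> \<Omega>" "x \<in> \<Omega> \<Longrightarrow> P x \<in> \<Omega> \<times> \<Omega>" "x \<in> \<Omega> \<Longrightarrow> Q x \<in> \<Omega> \<times> \<Omega>" for x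
    using abc by (auto simp: A_def P_def Q_def)
  have AP: "A \<noteq> P x" for x using abc(4) by (simp add: A_def P_def)
  have P_faithful: "\<exists>g. faithful ?Y \<psi> ({A} \<union> P ` insert c B) g" if "finite B" "B \<subseteq> \<Omega>" for B
    using that
  proof (induction B rule: finite_induct)
    case empty
    obtain g where g: "faithful ?Y \<psi> {A} g" using faithful_singleton[OF pts(1)] by blast
    have Z: "{A} \<subseteq> \<Omega> \<times> \<Omega>" "P c \<notin> {A}" "A \<in> {A}" using pts(1) AP[of c, symmetric] by simp_all
    obtain u' where "\<And>r. r \<in> ?Y \<Longrightarrow> (P c, A) \<in> r \<Longrightarrow> (u', g A) \<in> \<psi> r"
      using extension_candidate[OF g Z(1) pts(2)[OF abc(3)] Z(2,3,3)] by metis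
    then have "faithful ?Y \<psi> (insert (P c) {A}) (g(P c := u'))"
      by (intro faithful_insert[OF g Z(1,3) pts(2)[OF abc(3)] Z(2)]) auto
    then show ?case by (auto simp: insert_commute)
  next
    case (insert x B)
    let ?Z = "{A} \<union> P ` insert c B"
    show ?case
    proof (cases "x = c")
      case True
      then show ?thesis using insert by simp
    next
      case False
      obtain g where g: "faithful ?Y \<psi> ?Z g" using insert by auto
      have Z: "?Z \<subseteq> \<Omega> \<times> \<Omega>" using insert.prems abc by (auto simp: A_def P_def)
      have x: "P x \<in> \<Omega> \<times> \<Omega>" "P x \<notin> ?Z"
        using pts(2) insert False AP[of x, symmetric] by (auto simp: P_def)
      have mem: "A \<in> ?Z" "P c \<in> ?Z" by auto
      obtain u' where u': "u' \<in> \<Omega>' \<times> \<Omega>'" "u' \<notin> g ` ?Z"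
        and rA: "\<And>r. r \<in> ?Y \<Longrightarrow> (A, P x) \<in> r \<Longrightarrow> (g A, u') \<in> \<psi> r"
        and rC: "\<And>r. r \<in> ?Y \<Longrightarrow> (P x, P c) \<in> r \<Longrightarrow> (u', g (P c)) \<in> \<psi> r"
        by (rule extension_candidate[OF g Z x mem]) blast
      have "(u', g z) \<in> \<psi> s" if z: "z \<in> ?Z" and s: "s \<in> ?Y" "(P x, z) \<in> s" for z s
      proof (cases "z = A")
        case True
        have "(u', g A) \<in> \<psi> s" by (rule converse_rel[OF s(1)]) (use s True rA in auto)
        then show ?thesis using True by simp
      next
        case False
        then obtain y where y: "z = P y" using z by auto
        obtain r where r: "r \<in> ?Y" "(P c, P x) \<in> r" 
          using two.basis_cover[OF pts(2)[OF abc(3)] x(1)] by blast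
        have rC': "(g (P c), u') \<in> \<psi> r" by (rule converse_rel[OF r]) (rule rC)
        obtain v where v: "v \<in> \<Omega> \<times> \<Omega>" "v \<notin> ?Z" "(P c, v) \<in> r"
          and v': "\<And>t. t \<in> ?Y \<Longrightarrow> (v, z) \<in> t \<longleftrightarrow> (u', g z) \<in> \<psi> t"
          by (rule candidate_relation[OF g Z u' mem(2) z r(1) rC']) blast
        obtain r' where r': "r' \<in> ?Y" "(A, P x) \<in> r'" using two.basis_cover[OF pts(1) x(1)] by blast
        obtain w where w: "w \<in> \<Omega> \<times> \<Omega>" "w \<notin> ?Z" "(A, w) \<in> r'"
          and w': "\<And>t. t \<in> ?Y \<Longrightarrow> (w, z) \<in> t \<longleftrightarrow> (u', g z) \<in> \<psi> t"
          by (rule candidate_relation[OF g Z u' mem(1) z r'(1) rA[OF r']]) blast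
        \<comment> \<open>The candidate \<open>v\<close> is seen from \<open>P c\<close> and so has
          first coordinate \<open>c\<close>; \<open>w\<close>, seen from \<open>A\<close>, has the
          same relation to \<open>z = P y\<close>, hence also first coordinate \<open>c\<close>. As
          \<open>(A, w)\<close> lies in the basis relation of \<open>(A, P x)\<close>, it follows
          that \<open>w = P x\<close>.\<close>
        have "fst v = c" using first[OF r(1) v(3) r(2)] by (simp add: P_def)
        obtain t where t: "t \<in> ?Y" "(v, z) \<in> t" using two.basis_cover[OF v(1) subsetD[OF Z z]] by blast
        then have "(w, z) \<in> t" using v' w' by blast
        from first[OF t(1) this t(2)] have "fst w = c"
          using \<open>fst v = c\<close> by (simp add: y P_def)
        then have "w = P x"
          using determined[OF r'(1)] r'(2) w(3) unfolding A_def P_def by (metis prod.collapse)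
        then show ?thesis using w' s by blast
      qed
      then have "faithful ?Y \<psi> (insert (P x) ?Z) (g(P x := u'))"
        by (intro faithful_insert[OF g Z mem(1) x]) auto
      then show ?thesis by (auto simp: insert_commute)
    qed
  qed
  have "\<exists>g. faithful ?Y \<psi> ({A} \<union> P ` \<Omega> \<union> Q ` B) g" if "finite B" "B \<subseteq> \<Omega>" for B
    using that
  proof (induction B rule: finite_induct)
    case empty
    then show ?case
      using P_faithful[OF finite_points order_refl] abc(3) by (simp add: insert_absorb)
  next
    case (insert x B)
    let ?Z = "{A} \<union> P ` \<Omega> \<union> Q ` B"
    obtain g where g: "faithful ?Y \<psi> ?Z g" using insert by auto
    have Z: "?Z \<subseteq> \<Omega> \<times> \<Omega>" using insert.prems abc by (auto simp: A_def P_def Q_def)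
    have mem: "P x \<in> ?Z" using insert.prems by auto
    show ?case
    \<comment> \<open>The pair may be mapped already: \<open>Q c = P c\<close>.\<close>
    proof (cases "Q x \<in> ?Z")
      case True
      then have "{A} \<union> P ` \<Omega> \<union> Q ` insert x B = ?Z" by auto
      then show ?thesis using g by metis
    next
      case False
      have x: "Q x \<in> \<Omega> \<times> \<Omega>" using pts insert.prems by simp
      obtain u' where u': "u' \<in> \<Omega>' \<times> \<Omega>'" "u' \<notin> g ` ?Z"
        and rP: "\<And>r. r \<in> ?Y \<Longrightarrow> (P x, Q x) \<in> r \<Longrightarrow> (g (P x), u') \<in> \<psi> r"
        by (rule extension_candidate[OF g Z x False mem mem]) blast
      have "(u', g z) \<in> \<psi> s" if z: "z \<in> ?Z" and s: "s \<in> ?Y" "(Q x, z) \<in> s" for z s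
      proof -
        obtain r where r: "r \<in> ?Y" "(P x, Q x) \<in> r" 
          using two.basis_cover[OF subsetD[OF Z mem] x] by blast
        obtain v where v: "v \<in> \<Omega> \<times> \<Omega>" "v \<notin> ?Z" "(P x, v) \<in> r"
          and v': "\<And>t. t \<in> ?Y \<Longrightarrow> (v, z) \<in> t \<longleftrightarrow> (u', g z) \<in> \<psi> t"
          by (rule candidate_relation[OF g Z u' mem z r(1) rP[OF r]]) blast
        have "(P x, Q x) \<in> {((u, v), (v, v)) | u v. u \<in> \<Omega> \<and> v \<in> \<Omega>}"
          using abc insert.prems by (auto simp: P_def Q_def)
        then have "(P x, v) \<in> {((u, v), (v, v)) | u v. u \<in> \<Omega> \<and> v \<in> \<Omega>}"
          using two.union_closed[OF two_proj2 r] v(3) by blast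
        then have "v = Q x" by (auto simp: P_def Q_def)
        then show ?thesis using v' s by blast
      qed
      then have "faithful ?Y \<psi> (insert (Q x) ?Z) (g(Q x := u'))"
        by (intro faithful_insert[OF g Z mem x False]) auto
      then show ?thesis by auto
    qed
  qed
  from this[OF finite_points order_refl]
  obtain g where g: "faithful ?Y \<psi> ({A} \<union> P ` \<Omega> \<union> Q ` \<Omega>) g" by blast
  \<comment> \<open>\<open>\<psi>\<close> sends \<open>Delta s\<close> to
    \<open>Delta (\<phi> s)\<close>, so each \<open>g (Q x)\<close> is again a diagonal pair and
    \<open>fst\<close> reads off its point.\<close>
  have "faithful S \<phi> \<Omega> (\<lambda>x. fst (g (Q x)))"
    unfolding faithful_def
  proof (intro ballI impI)
    fix x y s assume x: "x \<in> \<Omega>" and y: "y \<in> \<Omega>" and s: "s \<in> S" "(x, y) \<in> s"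
    obtain t where t: "t \<in> ?Y" "(Q x, Q y) \<in> t" 
      using two.basis_cover[OF pts(3)[OF x] pts(3)[OF y]] by blast
    have "(Q x, Q y) \<in> Delta s" using s by (auto simp: Q_def Delta_def)
    then have "t \<subseteq> Delta s" using two.union_closed[OF two_Delta[OF union_basis[OF s(1)]] t] by blast
    then have "\<psi> t \<subseteq> Delta (\<phi> s)" using \<Delta>[OF s(1)] t(1) by (auto simp: on_unions_def)
    moreover have "(g (Q x), g (Q y)) \<in> \<psi> t" using g t x y unfolding faithful_def by blast
    ultimately show "(fst (g (Q x)), fst (g (Q y))) \<in> \<phi> s" by (auto simp: Delta_def)
  qed
  then show "\<exists>f. isomorphism \<Omega> S \<Omega>' S' f \<and> induced_by S \<phi> f"
    using one.faithful_induces abc(3) by blast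
qed

end

section \<open>Cyclotomic schemes\<close>

text \<open>Any candidate \<open>v\<close> outside \<open>Z\<close> is related to \<open>z\<close>
  as \<open>u\<close> is, since both differ from \<open>z\<close>; one known relation to
  \<open>a\<close> thus settles all others.\<close>

lemma (in alg_iso) rank_two_faithful:
  assumes same: "\<And>x y z w. x \<noteq> y \<Longrightarrow> z \<noteq> w \<Longrightarrow> x \<in> \<Omega> \<Longrightarrow> y \<in> \<Omega> \<Longrightarrow> z \<in> \<Omega> \<Longrightarrow> w \<in> \<Omega> \<Longrightarrow>
      \<exists>s\<in>S. (x, y) \<in> s \<and> (z, w) \<in> s"
  shows "\<exists>g. faithful S \<phi> \<Omega> g"
proof -
  have "\<exists>g. faithful S \<phi> B g" if "finite B" "B \<subseteq> \<Omega>" for B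
    using that
  proof (induction B rule: finite_induct)
    case empty
    show ?case by (rule exI) (simp add: faithful_def)
  next
    case (insert u Z)
    then obtain g where g: "faithful S \<phi> Z g" "Z \<subseteq> \<Omega>" by auto
    have u: "u \<in> \<Omega>" "u \<notin> Z" using insert by auto
    show ?case
    proof (cases "Z = {}")
      case True
      then show ?thesis using faithful_singleton[OF u(1)] by metis
    next
      case False
      then obtain a where a: "a \<in> Z" by blast
      obtain u' where u': "u' \<in> \<Omega>'" "u' \<notin> g ` Z"
        and ra: "\<And>r. r \<in> S \<Longrightarrow> (a, u) \<in> r \<Longrightarrow> (g a, u') \<in> \<phi> r"
        by (rule extension_candidate[OF g u a a]) blast
      have "(u', g z) \<in> \<phi> s" if z: "z \<in> Z" and s: "s \<in> S" "(u, z) \<in> s" for z s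
      proof -
        obtain r where r: "r \<in> S" "(a, u) \<in> r" using X.basis_cover[OF subsetD[OF g(2) a] u(1)] by blast
        obtain v where v: "v \<in> \<Omega>" "v \<notin> Z" "(a, v) \<in> r"
          and v': "\<And>t. t \<in> S \<Longrightarrow> (v, z) \<in> t \<longleftrightarrow> (u', g z) \<in> \<phi> t"
          by (rule candidate_relation[OF g u' a z r(1) ra[OF r]]) blast
        obtain t where t: "t \<in> S" "(v, z) \<in> t" "(u, z) \<in> t"
          using same[of v z u z] v(1,2) u z g(2) by blast
        have "t = s" by (rule X.basis_unique[OF t(1) s(1) t(3) s(2)])
        then show ?thesis using v' t by blast
      qed
      then show ?thesis using faithful_insert[OF g a u] by blast
    qed
  qed
  then show ?thesis using X.finite_points by blast
qed

text \<open>The points \<open>g ^ i\<close> and \<open>g ^ j\<close> are compared by the residue modulo \<open>m\<close> of the discrete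
  logarithm of \<open>g ^ j - g ^ i\<close>, with the value \<open>m\<close> standing for equality, and the colour of \<open>g ^ i\<close>
  consists of its relations to \<open>0\<close>, \<open>1\<close> and \<open>g\<close>.\<close>

definition diff_class :: "nat \<Rightarrow> nat list \<Rightarrow> nat \<Rightarrow> nat \<Rightarrow> nat \<Rightarrow> nat" where
  "diff_class n L m i j = (if i = j then m else (i + L ! ((j + (n - i)) mod n)) mod m)"

definition colour :: "nat \<Rightarrow> nat list \<Rightarrow> nat \<Rightarrow> nat \<Rightarrow> nat \<times> nat \<times> nat" where
  "colour n L m i = (i mod m, diff_class n L m 0 i, diff_class n L m 1 i)"

definition colour_degree :: "nat \<Rightarrow> nat list \<Rightarrow> nat \<Rightarrow> nat \<Rightarrow> nat \<times> nat \<times> nat \<Rightarrow> nat \<Rightarrow> nat" where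
  "colour_degree n L m i k s =
     length (filter (\<lambda>z. colour n L m z = k \<and> diff_class n L m z i = s) [0..<n])"

definition distinguishes :: "nat \<Rightarrow> nat list \<Rightarrow> nat \<Rightarrow> bool" where
  "distinguishes n L m \<longleftrightarrow> list_all (\<lambda>i. list_all (\<lambda>j.
     colour n L m i \<noteq> colour n L m j \<or>
     list_ex (\<lambda>z. list_ex (\<lambda>s. colour_degree n L m i (colour n L m z) s \<noteq>
         colour_degree n L m j (colour n L m z) s) [0..<m]) [0..<n]) [0..<i]) [0..<n]"

lemma distinguishesD:
  assumes "distinguishes n L m" "j < i" "i < n" "colour n L m i = colour n L m j"
  shows "\<exists>z s. colour_degree n L m i (colour n L m z) s \<noteq> colour_degree n L m j (colour n L m z) s"
proof -
  have "list_ex (\<lambda>z. list_ex (\<lambda>s. colour_degree n L m i (colour n L m z) s \<noteq>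
      colour_degree n L m j (colour n L m z) s) [0..<m]) [0..<n]"
    using assms by (simp add: distinguishes_def list_all_iff)
  then show ?thesis unfolding list_ex_iff by blast
qed

section \<open>Differences classified by their discrete logarithm modulo \<open>m\<close>\<close>

context primitive_element
begin

definition log_class :: "nat \<Rightarrow> nat \<Rightarrow> ('a \<times> 'a) set" where
  "log_class m s = (if s = m then Id else {(x, y). \<exists>k. k mod m = s \<and> y - x = g ^ k})"

lemma log_mod:
  assumes "m dvd n" "g ^ k = g ^ l"
  shows "k mod m = l mod m"
  using assms power_eq_iff by (metis mod_mod_cancel)

lemma log_class_iff:
  assumes "m dvd n" "s \<noteq> m" "y - x = g ^ k"
  shows "(x, y) \<in> log_class m s \<longleftrightarrow> k mod m = s"
proof -
  have "(x, y) \<in> log_class m s \<longleftrightarrow> (\<exists>l. l mod m = s \<and> g ^ k = g ^ l)"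
    using assms(2,3) by (simp add: log_class_def)
  also have "\<dots> \<longleftrightarrow> k mod m = s" using log_mod[OF assms(1)] by metis
  finally show ?thesis .
qed

lemma log_class_zero:
  assumes "m dvd n" "s < m"
  shows "(0, g ^ i) \<in> log_class m s \<longleftrightarrow> i mod m = s"
  by (rule log_class_iff[OF assms(1)]) (use assms(2) in simp_all)

text \<open>The difference is \<open>g ^ i\<close> times a power of \<open>g\<close> minus one, and
  the Zech table supplies the logarithm of the second factor.\<close>

lemma log_class_powers:
  assumes m: "m dvd n" and ij: "i < n" "j < n"
  shows "(g ^ i, g ^ j) \<in> log_class m s \<longleftrightarrow> diff_class n L m i j = s"
proof (cases "i = j")
  case True
  then show ?thesis using nonzero by (auto simp: log_class_def diff_class_def)
next
  case False
  let ?k = "(j + (n - i)) mod n"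
  have ne: "g ^ j \<noteq> g ^ i" using False ij power_eq_iff by simp
  have "m \<noteq> 0" using m pos by (metis dvd_0_left_iff less_numeral_extra(3))
  have "g ^ ?k * g ^ i = g ^ (j + n)"
    using ij by (simp add: power_mod power_add[symmetric])
  then have shift: "g ^ ?k * g ^ i = g ^ j" by (simp only: power_add period mult_1_right)
  then have "?k \<noteq> 0" using ne by (metis mult_1 power_0)
  then have "g ^ (L ! ?k) + 1 = g ^ ?k" using zech pos by simp
  then have "(g ^ (L ! ?k) + 1) * g ^ i = g ^ j" using shift by simp
  then have diff: "g ^ j - g ^ i = g ^ (i + L ! ?k)" by (simp add: power_add algebra_simps)
  show ?thesis
  proof (cases "s = m")
    case True
    have "(i + L ! ?k) mod m < m" using \<open>m \<noteq> 0\<close> by simp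
    then show ?thesis using True False ne by (auto simp: log_class_def diff_class_def)
  next
    case False
    then show ?thesis
      using log_class_iff[OF m False diff] \<open>i \<noteq> j\<close> by (simp add: diff_class_def)
  qed
qed

text \<open>Differences within one basis relation differ by a factor in \<open>M\<close>, whose
  logarithm is a multiple of \<open>m\<close>.\<close>

lemma log_class_union:
  assumes M: "mult_subgroup M" and sub: "\<And>x. x \<in> M \<Longrightarrow> \<exists>k. m dvd k \<and> x = g ^ k"
  shows "is_union_of (log_class m s) (cyclotomic_basis M)"
proof -
  interpret coherent UNIV "cyclotomic_basis M"
    using scheme_cyclotomic_basis[OF fin M] by unfold_locales (simp add: scheme_def)
  show ?thesis
  proof (cases "s = m")
    case True
    moreover have "Id_on UNIV = (Id :: ('a \<times> 'a) set)" by auto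
    ultimately show ?thesis using union_Id by (simp add: log_class_def)
  next
    case False
    show ?thesis
      unfolding union_iff
    proof (intro conjI ballI impI)
      fix t p q assume t: "t \<in> cyclotomic_basis M" "p \<in> t" "q \<in> t" and p: "p \<in> log_class m s"
      obtain a where t_def: "t = {(x, y). y - x \<in> (\<lambda>m. m * a) ` M}"
        using t(1) by (auto simp: cyclotomic_basis_def)
      obtain x y z w where xy: "p = (x, y)" "q = (z, w)" by (metis surj_pair)
      obtain u v where uv: "u \<in> M" "y - x = u * a" "v \<in> M" "w - z = v * a"
        using t(2,3) by (auto simp: t_def xy)
      obtain k where k: "k mod m = s" "y - x = g ^ k"
        using p False by (auto simp: log_class_def xy)
      have "u \<noteq> 0" "v * inverse u \<in> M" using M uv by (auto simp: mult_subgroup_def)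
      then obtain l where l: "m dvd l" "v * inverse u = g ^ l" using sub by blast
      have "w - z = (v * inverse u) * (y - x)" unfolding uv using \<open>u \<noteq> 0\<close> by simp
      also have "\<dots> = g ^ (k + l)" unfolding k l by (simp add: power_add)
      finally have "w - z = g ^ (k + l)" .
      moreover have "(k + l) mod m = s" using l k by (auto simp: mod_add_eq[symmetric])
      ultimately show "q \<in> log_class m s" using False by (auto simp: log_class_def xy)
    qed simp
  qed
qed

lemma two_separable_powers:
  assumes M: "mult_subgroup M" and m: "m dvd n" and sub: "\<And>x. x \<in> M \<Longrightarrow> \<exists>k. m dvd k \<and> x = g ^ k"
    and n1: "1 < n" and dist: "distinguishes n L m"
  shows "two_separable TYPE('b) UNIV (cyclotomic_basis M)"
proof -
  interpret coherent UNIV "cyclotomic_basis M"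
    using scheme_cyclotomic_basis[OF fin M] by unfold_locales (simp add: scheme_def)
  note union = log_class_union[OF M sub]
  have m0: "0 < m" using m pos by (metis dvd_0_left_iff gr0I less_numeral_extra(3))
  show ?thesis
  proof (rule two_separable_three_points[where a = 0 and b = "g ^ 0" and c = "g ^ 1"])
    show "0 \<noteq> g ^ 1" using nonzero by simp
    fix t x y
    assume t: "t \<in> two_extension UNIV (cyclotomic_basis M)" "((0, g ^ 0), (g ^ 1, x)) \<in> t"
      "((0, g ^ 0), (g ^ 1, y)) \<in> t"
    \<comment> \<open>Asking for \<open>z = 0\<close> and \<open>z = x\<close> makes the count
      \<open>1\<close> exactly for \<open>x = 0\<close>.\<close>
    have zero: "x = 0 \<longleftrightarrow> y = 0"
    proof -
      define N where "N x = {z. (0, z) \<in> Id_on UNIV \<and> (g ^ 0, z) \<in> UNIV \<times> UNIV \<and>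
        (g ^ 1, z) \<in> UNIV \<times> UNIV \<and> (z, x) \<in> Id_on UNIV}" for x :: 'a
      have "card (N x) = card (N y)"
        unfolding N_def by (rule two_count[OF union_Id union_full union_full union_Id t])
      moreover have "N x = (if x = 0 then {0} else {})" for x by (auto simp: N_def)
      ultimately show ?thesis by (simp split: if_splits)
    qed
    show "x = y"
    proof (cases "x = 0")
      case True
      then show ?thesis using zero by simp
    next
      case False
      then obtain i j where ij: "i < n" "x = g ^ i" "j < n" "y = g ^ j"
        using power_exists zero by metis
      define N where "N k s x = {z. (0, z) \<in> log_class m (fst k) \<and>
        (g ^ 0, z) \<in> log_class m (fst (snd k)) \<and> (g ^ 1, z) \<in> log_class m (snd (snd k)) \<and>
        (z, x) \<in> log_class m s}" for k s x
      have cards: "card (N k s x) = card (N k s y)" for k s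
        unfolding N_def by (rule two_count[OF union union union union t])
      have mem: "g ^ l \<in> N k s (g ^ i) \<longleftrightarrow> colour n L m l = k \<and> diff_class n L m l i = s"
        if "l < n" "i < n" "fst k < m" for l k s i
        unfolding N_def colour_def prod_eq_iff mem_Collect_eq fst_conv snd_conv
          log_class_zero[OF m that(3)] log_class_powers[OF m pos(1) that(1)]
          log_class_powers[OF m n1 that(1)] log_class_powers[OF m that(1,2)] by simp
      have deg: "card (N k s (g ^ i)) = colour_degree n L m i k s" if "i < n" "fst k < m" for k s i
      proof -
        \<comment> \<open>\<open>colour_degree\<close> leaves out zero, which has no logarithm; a
          class below \<open>m\<close> demands a nonzero difference from \<open>0\<close>, which
          keeps zero out of \<open>N\<close> as well.\<close>
        have "0 \<notin> N k s (g ^ i)"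
        proof
          assume "0 \<in> N k s (g ^ i)"
          then have "(0, 0) \<in> log_class m (fst k)" by (simp add: N_def)
          then show False using that(2) nonzero by (auto simp: log_class_def)
        qed
        then have "N k s (g ^ i) \<subseteq> (^) g ` {..<n}" unfolding power_image by auto
        then have "N k s (g ^ i) =
            (^) g ` {l. l < n \<and> colour n L m l = k \<and> diff_class n L m l i = s}"
          using mem[OF _ that] by fastforce
        moreover have "card ((^) g ` {l. l < n \<and> colour n L m l = k \<and> diff_class n L m l i = s}) =
            card {l. l < n \<and> colour n L m l = k \<and> diff_class n L m l i = s}"
          by (rule card_image) (rule inj_on_subset[OF power_inj], auto)
        moreover have "{l. l < n \<and> colour n L m l = k \<and> diff_class n L m l i = s} =
            set (filter (\<lambda>z. colour n L m z = k \<and> diff_class n L m z i = s) [0..<n])"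
          by auto
        moreover have "card (set (filter (\<lambda>z. colour n L m z = k \<and> diff_class n L m z i = s) [0..<n])) =
            colour_degree n L m i k s"
          unfolding colour_degree_def by (rule distinct_card) simp
        ultimately show ?thesis by (simp only:)
      qed
      have fst_colour: "fst (colour n L m l) < m" for l using m0 by (simp add: colour_def)
      \<comment> \<open>Class \<open>m\<close> is equality, so for the colour of \<open>x\<close>
        only \<open>x\<close> itself is counted; as the count for \<open>y\<close> is also
        \<open>1\<close>, \<open>y\<close> has that colour.\<close>
      have same_colour: "colour n L m i = colour n L m j"
      proof -
        have single: "N k m z \<subseteq> {z}" for k z by (auto simp: N_def log_class_def[of m m])
        have "x \<in> N (colour n L m i) m x"
          unfolding ij(2) mem[OF ij(1,1) fst_colour] by (simp add: diff_class_def)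
        then have "N (colour n L m i) m x = {x}" using single by blast
        then have "card (N (colour n L m i) m y) = 1" using cards[of "colour n L m i" m] by simp
        then obtain z where "N (colour n L m i) m y = {z}" by (auto simp: card_1_singleton_iff)
        then have "y \<in> N (colour n L m i) m y" using single[of "colour n L m i" y] by blast
        then show ?thesis unfolding ij(4) mem[OF ij(3,3) fst_colour] by simp
      qed
      have same_degree: "colour_degree n L m i (colour n L m l) s = colour_degree n L m j (colour n L m l) s"
        for l s
        using cards[of "colour n L m l" s] deg[OF ij(1) fst_colour] deg[OF ij(3) fst_colour]
        unfolding ij by simp
      have "\<not> j < i"
        using distinguishesD[OF dist _ ij(1), of j] same_colour same_degree by blast
      moreover have "\<not> i < j"
        using distinguishesD[OF dist _ ij(3), of i] same_colour[symmetric] same_degree[symmetric] by blast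
      ultimately have "i = j" by simp
      then show ?thesis unfolding ij by simp
    qed
  qed simp_all
qed

text \<open>By division with remainder, the exponents of powers of \<open>g\<close> in
  \<open>M\<close> are multiples of the least positive one, \<open>e\<close>. Properness gives
  \<open>e \<noteq> 1\<close>, and any prime factor of \<open>e\<close> will do; it divides
  \<open>n\<close> because \<open>g ^ n = 1\<close> lies in \<open>M\<close>.\<close>

lemma proper_subgroup:
  assumes M: "mult_subgroup M" and proper: "M \<noteq> UNIV - {0}"
  shows "\<exists>m. prime m \<and> m dvd n \<and> (\<forall>x\<in>M. \<exists>k. m dvd k \<and> x = g ^ k)"
proof -
  have mult: "x * y \<in> M" if "x \<in> M" "y \<in> M" for x y using M that by (auto simp: mult_subgroup_def)
  have power: "x ^ k \<in> M" if "x \<in> M" for x k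
    using M that by (induction k) (auto simp: mult_subgroup_def)
  define e where "e = (LEAST k. 0 < k \<and> g ^ k \<in> M)"
  have "0 < n \<and> g ^ n \<in> M" using pos period M by (simp add: mult_subgroup_def)
  then have e: "0 < e" "g ^ e \<in> M" unfolding e_def by (metis (mono_tags, lifting) LeastI)+
  have dvd: "e dvd k" if "g ^ k \<in> M" for k
  proof -
    have "g ^ (k mod e) * (g ^ e) ^ (k div e) = g ^ k"
      by (simp add: power_mult[symmetric] power_add[symmetric])
    then have "g ^ (k mod e) = g ^ k * inverse ((g ^ e) ^ (k div e))"
      using nonzero by (simp add: field_simps)
    moreover have "inverse ((g ^ e) ^ (k div e)) \<in> M"
      using power[OF e(2)] M by (auto simp: mult_subgroup_def)
    ultimately have "g ^ (k mod e) \<in> M" using mult[OF that] by simp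
    then have "\<not> 0 < k mod e"
      using not_less_Least[of "k mod e" "\<lambda>k. 0 < k \<and> g ^ k \<in> M"] e(1) by (auto simp: e_def)
    then show ?thesis by auto
  qed
  have "e \<noteq> 1"
  proof
    assume "e = 1"
    then have "g ^ k \<in> M" for k using power[OF e(2)] by simp
    then have "UNIV - {0} \<subseteq> M" using power_exists by blast
    then show False using proper M by (auto simp: mult_subgroup_def)
  qed
  then obtain m where m: "prime m" "m dvd e" using prime_factor_nat by blast
  have "m dvd n" using m dvd[of n] \<open>0 < n \<and> g ^ n \<in> M\<close> by (metis dvd_trans)
  moreover have "\<exists>k. m dvd k \<and> x = g ^ k" if "x \<in> M" for x
  proof -
    have "x \<noteq> 0" using that M by (auto simp: mult_subgroup_def)
    then obtain k where "x = g ^ k" using power_exists by blast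
    then show ?thesis using dvd m that by (metis dvd_trans)
  qed
  ultimately show ?thesis using m by blast
qed

lemma two_separable_cyclotomic:
  assumes M: "mult_subgroup (M :: 'a set)" and n1: "1 < n"
    and dist: "\<And>m. prime m \<Longrightarrow> m dvd n \<Longrightarrow> distinguishes n L m"
  shows "two_separable TYPE('b) UNIV (cyclotomic_basis M)"
proof (cases "M = UNIV - {0}")
  case False
  then show ?thesis using proper_subgroup[OF M] two_separable_powers[OF M _ _ n1] dist by blast
next
  case True
  show ?thesis
    unfolding two_separable_def
  proof (intro allI impI, elim conjE)
    fix \<Omega>' :: "'b set" and S' \<phi>
    assume "coherent_configuration \<Omega>' S'" "two_isomorphism UNIV (cyclotomic_basis M) \<Omega>' S' \<phi>"
    then interpret alg_iso "UNIV :: 'a set" "cyclotomic_basis M" \<Omega>' S' \<phi>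
      using scheme_cyclotomic_basis[OF fin M]
      by unfold_locales (simp_all add: scheme_def two_isomorphism_def)
    have "\<exists>f. faithful (cyclotomic_basis M) \<phi> UNIV f"
    proof (rule rank_two_faithful)
      fix x y z w :: 'a assume "x \<noteq> y" "z \<noteq> w"
      then have "(x, y) \<in> {(u, v). v - u \<in> (\<lambda>m. m * 1) ` M}" "(z, w) \<in> {(u, v). v - u \<in> (\<lambda>m. m * 1) ` M}"
        by (auto simp: True)
      moreover have "{(u, v). v - u \<in> (\<lambda>m. m * 1) ` M} \<in> cyclotomic_basis M"
        unfolding cyclotomic_basis_def by (intro CollectI exI[of _ 1] conjI refl TrueI)
      ultimately show "\<exists>s\<in>cyclotomic_basis M. (x, y) \<in> s \<and> (z, w) \<in> s"
        by (intro bexI conjI)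
    qed
    then show "\<exists>f. isomorphism UNIV (cyclotomic_basis M) \<Omega>' S' f \<and> induced_by (cyclotomic_basis M) \<phi> f"
      using faithful_induces by blast
  qed
qed

end

section \<open>The seven fields\<close>

text \<open>The orders in which the points are reconstructed come from a greedy search.\<close>

definition zech_4 :: "nat list" where
  "zech_4 =
    [0, 2, 1]"

text \<open>The list \<open>[1, 1]\<close> encodes \<open>x ^ 2 = 1 + x\<close>, constant term
  first; likewise \<open>[2, 2]\<close> modulo 5 below is \<open>x ^ 2 = 2 + 2 * x\<close>.\<close>

lemma zech_table_4: "zech_table 2 [1, 1] 3 zech_4"
  by code_simp

text \<open>The moduli are the prime divisors of \<open>n\<close>, which suffice by
  \<open>proper_subgroup\<close>.\<close>

lemma distinguishes_4_3: "distinguishes 3 zech_4 3"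
  by code_simp

lemma reconstructs_4: "reconstructs (cyc_rel 3 2 2) (cyc_nbrs 3 2 2) 3 [0]
    [(1, 0), (2, 1)]"
  by code_simp

definition zech_8 :: "nat list" where
  "zech_8 =
    [0, 5, 3, 2, 6, 1, 4]"

lemma zech_table_8: "zech_table 2 [1, 0, 1] 7 zech_8"
  by code_simp

lemma distinguishes_8_7: "distinguishes 7 zech_8 7"
  by code_simp

lemma reconstructs_8: "reconstructs (cyc_rel 7 2 3) (cyc_nbrs 7 2 3) 7 [0]
    [(1, 0), (2, 1), (4, 1), (6, 1), (3, 2), (5, 1)]"
  by code_simp

definition zech_16 :: "nat list" where
  "zech_16 =
    [0, 12, 9, 4, 3, 10, 8, 13, 6, 2, 5, 14, 1, 7, 11]"

lemma zech_table_16: "zech_table 2 [1, 0, 0, 1] 15 zech_16"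
  by code_simp

lemma distinguishes_16_3: "distinguishes 15 zech_16 3"
  by code_simp

lemma distinguishes_16_5: "distinguishes 15 zech_16 5"
  by code_simp

lemma reconstructs_16: "reconstructs (cyc_rel 15 2 4) (cyc_nbrs 15 2 4) 15 [0]
    [(1, 0), (2, 1), (4, 1), (8, 1), (6, 1), (5, 1), (10, 1), (11, 1), (12, 1), (14, 1), (3, 2),
    (9, 1), (7, 2), (13, 1)]"
  by code_simp

definition zech_32 :: "nat list" where
  "zech_32 =
    [0, 14, 28, 5, 25, 3, 10, 16, 19, 24, 6, 23, 20, 30, 1, 22, 7, 18, 17, 8, 12, 27, 15, 11, 9,
    4, 29, 21, 2, 26, 13]"

lemma zech_table_32: "zech_table 2 [1, 0, 0, 1, 0] 31 zech_32"
  by code_simp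

lemma distinguishes_32_31: "distinguishes 31 zech_32 31"
  by code_simp

lemma reconstructs_32: "reconstructs (cyc_rel 31 2 5) (cyc_nbrs 31 2 5) 31 [0]
    [(1, 0), (2, 1), (4, 1), (8, 1), (16, 1), (30, 1), (20, 1), (18, 1), (10, 1), (13, 1), (14,
    1), (12, 1), (6, 1), (19, 1), (22, 1), (24, 1), (26, 1), (28, 1), (3, 2), (17, 1), (5, 2),
    (9, 1), (7, 2), (25, 1), (11, 2), (21, 1), (27, 2), (23, 1), (15, 2), (29, 1)]"
  by code_simp

definition zech_9 :: "nat list" where
  "zech_9 =
    [0, 7, 1, 5, 0, 6, 3, 2]"

lemma zech_table_9: "zech_table 3 [1, 1] 8 zech_9"
  by code_simp

lemma distinguishes_9_2: "distinguishes 8 zech_9 2"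
  by code_simp

lemma reconstructs_9: "reconstructs (cyc_rel 8 3 2) (cyc_nbrs 8 3 2) 8 [0]
    [(1, 0), (2, 1), (3, 1), (4, 1), (5, 1), (6, 1), (7, 1)]"
  by code_simp

definition zech_27 :: "nat list" where
  "zech_27 =
    [0, 11, 3, 7, 10, 24, 9, 2, 22, 21, 12, 18, 4, 0, 5, 20, 15, 25, 1, 8, 16, 6, 19, 17, 14,
    23]"

lemma zech_table_27: "zech_table 3 [2, 0, 1] 26 zech_27"
  by code_simp

lemma distinguishes_27_2: "distinguishes 26 zech_27 2"
  by code_simp

lemma distinguishes_27_13: "distinguishes 26 zech_27 13"
  by code_simp

lemma reconstructs_27: "reconstructs (cyc_rel 26 3 3) (cyc_nbrs 26 3 3) 26 [0]
    [(1, 0), (2, 1), (3, 1), (5, 1), (6, 1), (7, 1), (8, 1), (9, 1), (11, 1), (12, 1), (13, 1),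
    (14, 1), (15, 1), (16, 1), (18, 1), (19, 1), (20, 1), (21, 1), (22, 1), (24, 1), (25, 1),
    (4, 2), (10, 1), (17, 2), (23, 1)]"
  by code_simp

definition zech_25 :: "nat list" where
  "zech_25 =
    [0, 3, 11, 17, 8, 15, 18, 23, 1, 10, 7, 19, 6, 20, 9, 13, 5, 4, 0, 22, 16, 2, 21, 14]"

lemma zech_table_25: "zech_table 5 [2, 2] 24 zech_25"
  by code_simp

lemma distinguishes_25_2: "distinguishes 24 zech_25 2"
  by code_simp

lemma distinguishes_25_3: "distinguishes 24 zech_25 3"
  by code_simp

lemma reconstructs_25: "reconstructs (cyc_rel 24 5 2) (cyc_nbrs 24 5 2) 24 [0]
    [(1, 0), (2, 1), (3, 1), (4, 1), (5, 1), (6, 1), (7, 1), (8, 1), (9, 1), (10, 1), (11, 1),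
    (12, 1), (13, 1), (14, 1), (15, 1), (16, 1), (17, 1), (18, 1), (19, 1), (20, 1), (21, 1),
    (22, 1), (23, 1)]"
  by code_simp

section \<open>Deduction of the result from the computations\<close>

lemma prime_divisors:
  fixes m :: nat
  assumes "prime m"
  shows "m dvd 3 \<Longrightarrow> m = 3" "m dvd 7 \<Longrightarrow> m = 7" "m dvd 15 \<Longrightarrow> m = 3 \<or> m = 5" "m dvd 31 \<Longrightarrow> m = 31"
    "m dvd 8 \<Longrightarrow> m = 2" "m dvd 26 \<Longrightarrow> m = 2 \<or> m = 13" "m dvd 24 \<Longrightarrow> m = 2 \<or> m = 3"
proof -
  have eq: "m = k" if "prime k" "m dvd k" for k using primes_dvd_imp_eq assms that by blast
  note mult = prime_dvd_mult_iff[OF assms] and power = prime_dvd_power_iff[OF assms]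
  show "m dvd 3 \<Longrightarrow> m = 3" "m dvd 7 \<Longrightarrow> m = 7" "m dvd 31 \<Longrightarrow> m = 31" by (rule eq; simp)+
  show "m = 3 \<or> m = 5" if "m dvd 15"
    using that mult[of 3 5] eq[of 3] eq[of 5] by auto
  show "m = 2" if "m dvd 8"
    using that power[of 3 2] eq[of 2] by auto
  show "m = 2 \<or> m = 13" if "m dvd 26"
    using that mult[of 2 13] eq[of 2] eq[of 13] by auto
  show "m = 2 \<or> m = 3" if "m dvd 24"
    using that mult[of "2 ^ 3" 3] power[of 3 2] eq[of 2] eq[of 3] by auto
qed

text \<open>Reduces both claims for one field to computations: the Zech table, a reconstruction
  order, and the colour check for each prime divisor of \<open>n\<close>.\<close>

lemma small_field:
  assumes "prime p" "CARD('a::field) = p ^ d" "length c = d" "n = p ^ d - 1" "1 < n"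
    and "zech_table p c n L" and "reconstructs (cyc_rel n p d) (cyc_nbrs n p d) n [0] cs"
    and "\<And>m. prime m \<Longrightarrow> m dvd n \<Longrightarrow> distinguishes n L m"
  shows "separable TYPE('b) (UNIV - {0 :: 'a}) C_basis \<and>
         (\<forall>M :: 'a set. mult_subgroup M \<longrightarrow> two_separable TYPE('b) UNIV (cyclotomic_basis M))"
proof -
  obtain g :: 'a where g: "primitive_element g p c n L"
    using primitive_element_exists[of p c n L] assms by auto
  show ?thesis
    using primitive_element.separable_C_basis[OF g assms(5)]
      primitive_element.two_separable_cyclotomic[OF g _ assms(5,8)] assms(3,7) by blast
qed

theorem theorem6p2:
  fixes p d :: nat
  assumes "(p, d) \<in> {(2, 2), (2, 3), (2, 4), (2, 5), (3, 2), (3, 3), (5, 2)}"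
    and "CARD('a::field) = p ^ d"
  shows "separable TYPE('b) (UNIV - {0 :: 'a}) C_basis \<and>
         (\<forall>M :: 'a set. mult_subgroup M \<longrightarrow> two_separable TYPE('b) UNIV (cyclotomic_basis M))"
proof -
  have case_4: ?thesis if "p = 2" "d = 2"
  proof (rule small_field[OF _ _ _ _ _ zech_table_4 reconstructs_4])
    show "CARD('a) = 2 ^ 2" using assms(2) that by simp
    show "distinguishes 3 zech_4 m" if "prime m" "m dvd 3" for m
      using prime_divisors(1)[OF that] distinguishes_4_3 by auto
  qed simp_all
  have case_8: ?thesis if "p = 2" "d = 3"
  proof (rule small_field[OF _ _ _ _ _ zech_table_8 reconstructs_8])
    show "CARD('a) = 2 ^ 3" using assms(2) that by simp
    show "distinguishes 7 zech_8 m" if "prime m" "m dvd 7" for m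
      using prime_divisors(2)[OF that] distinguishes_8_7 by auto
  qed simp_all
  have case_16: ?thesis if "p = 2" "d = 4"
  proof (rule small_field[OF _ _ _ _ _ zech_table_16 reconstructs_16])
    show "CARD('a) = 2 ^ 4" using assms(2) that by simp
    show "distinguishes 15 zech_16 m" if "prime m" "m dvd 15" for m
      using prime_divisors(3)[OF that] distinguishes_16_3 distinguishes_16_5 by auto
  qed simp_all
  have case_32: ?thesis if "p = 2" "d = 5"
  proof (rule small_field[OF _ _ _ _ _ zech_table_32 reconstructs_32])
    show "CARD('a) = 2 ^ 5" using assms(2) that by simp
    show "distinguishes 31 zech_32 m" if "prime m" "m dvd 31" for m
      using prime_divisors(4)[OF that] distinguishes_32_31 by auto
  qed simp_all
  have case_9: ?thesis if "p = 3" "d = 2"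
  proof (rule small_field[OF _ _ _ _ _ zech_table_9 reconstructs_9])
    show "CARD('a) = 3 ^ 2" using assms(2) that by simp
    show "distinguishes 8 zech_9 m" if "prime m" "m dvd 8" for m
      using prime_divisors(5)[OF that] distinguishes_9_2 by auto
  qed simp_all
  have case_27: ?thesis if "p = 3" "d = 3"
  proof (rule small_field[OF _ _ _ _ _ zech_table_27 reconstructs_27])
    show "CARD('a) = 3 ^ 3" using assms(2) that by simp
    show "distinguishes 26 zech_27 m" if "prime m" "m dvd 26" for m
      using prime_divisors(6)[OF that] distinguishes_27_2 distinguishes_27_13 by auto
  qed simp_all
  have case_25: ?thesis if "p = 5" "d = 2"
  proof (rule small_field[OF _ _ _ _ _ zech_table_25 reconstructs_25])
    show "CARD('a) = 5 ^ 2" using assms(2) that by simp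
    show "distinguishes 24 zech_25 m" if "prime m" "m dvd 24" for m
      using prime_divisors(7)[OF that] distinguishes_25_2 distinguishes_25_3 by auto
  qed simp_all
  show ?thesis
    using assms(1) case_4 case_8 case_16 case_32 case_9 case_27 case_25 by blast
qed

end
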